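(* Let $D$ be the dihedral group of order $8$, acting on the set $Y$ of the four vertices of a square by symmetries of the square. If $t\in D$ is one of the two reflections that fix no vertex, then $c(D,Y,t)=2=\tfrac12|Y|$. On the other hand, if $K/\mathbb{Q}$ is a totally imaginary number field with $[K:\mathbb{Q}]=4$ and $\mathrm{Gal}(K^{\mathrm{gal}}/\mathbb{Q})\cong D$, where $K^{\mathrm{gal}}$ is the Galois hull of $K/\mathbb{Q}$, then for every linear form $l\in K[x_1,x_2,x_3]$ the form $f=N_{K/\mathbb{Q}}(l)\in\mathbb{Q}[x_1,x_2,x_3]$ is a sum of squares of polynomials in $\mathbb{Q}[x_1,x_2,x_3]$.
   Context: Characteristic number: let a finite group $G$ act transitively and faithfully on a finite set $X$, and let $t\in G$ be an involution acting on $X$ without fixed points. For $x\in X$ put $M_t(x)=\{gtg^{-1}x : g\in G\}$. The cardinality $|M_t(x)|$ does not depend on $x\in X$; it is denoted $c(G,X,t)$. Norm form: for a linear form $l\in K[x_1,x_2,x_3]$, $N_{K/\mathbb{Q}}(l)$ is the product of the $[K:\mathbb{Q}]$ Galois conjugates of $l$, i.e. of the forms obtained by applying the embeddings $K\to\mathbb{C}$ to the coefficients of $l$. *)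

theory Defs
  imports
    "HOL-Analysis.Analysis"
    "HOL-Algebra.Group_Action"
    "HOL-Algebra.Generated_Fields"
    "HOL-Algebra.Algebraic_Closure_Type"
    "HOL-Library.Poly_Mapping"
begin

section \<open>The characteristic number\<close>

definition conj_translates :: "('g, 'b) monoid_scheme \<Rightarrow> ('g \<Rightarrow> 'x \<Rightarrow> 'x) \<Rightarrow> 'g \<Rightarrow> 'x \<Rightarrow> 'x set" where
  "conj_translates G \<phi> t x = {\<phi> (g \<otimes>\<^bsub>G\<^esub> t \<otimes>\<^bsub>G\<^esub> inv\<^bsub>G\<^esub> g) x | g. g \<in> carrier G}"

definition char_number :: "('g, 'b) monoid_scheme \<Rightarrow> 'x set \<Rightarrow> ('g \<Rightarrow> 'x \<Rightarrow> 'x) \<Rightarrow> 'g \<Rightarrow> nat" where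
  "char_number G E \<phi> t = (THE c. \<forall>x\<in>E. card (conj_translates G \<phi> t x) = c)"

text \<open>The setting in which the characteristic number is considered.\<close>

locale involution_action =
  faithful_action G E \<phi> + transitive_action G E \<phi>
  for G (structure) and E and \<phi> +
  fixes t
  assumes finite_group: "finite (carrier G)"
    and finite_set: "finite E"
    and t_closed: "t \<in> carrier G"
    and t_nontrivial: "t \<noteq> \<one>"
    and t_involution: "t \<otimes> t = \<one>"
    and t_no_fixed_points: "invariants E \<phi> t = {}"

lemma (in involution_action) conj_translates_move:
  assumes "h \<in> carrier G" "x \<in> E"
  shows "conj_translates G \<phi> t (\<phi> h x) = \<phi> h ` conj_translates G \<phi> t x"
proof -
  interpret group G
    using group_hom by (simp add: group_hom_def)
  have *: "\<phi> (g \<otimes> t \<otimes> inv g) (\<phi> h x) = \<phi> h (\<phi> ((inv h \<otimes> g) \<otimes> t \<otimes> inv (inv h \<otimes> g)) x)"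
    if g: "g \<in> carrier G" for g
  proof -
    have "h \<otimes> ((inv h \<otimes> g) \<otimes> t \<otimes> inv (inv h \<otimes> g)) = (g \<otimes> t \<otimes> inv g) \<otimes> h"
      using g assms(1) t_closed by (simp add: inv_mult_group m_assoc) (simp flip: m_assoc)
    moreover have "\<phi> (h \<otimes> ((inv h \<otimes> g) \<otimes> t \<otimes> inv (inv h \<otimes> g))) x
        = \<phi> h (\<phi> ((inv h \<otimes> g) \<otimes> t \<otimes> inv (inv h \<otimes> g)) x)"
      using g assms t_closed by (intro composition_rule) auto
    moreover have "\<phi> ((g \<otimes> t \<otimes> inv g) \<otimes> h) x = \<phi> (g \<otimes> t \<otimes> inv g) (\<phi> h x)"
      using g assms t_closed by (intro composition_rule) auto
    ultimately show ?thesis by simp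
  qed
  show ?thesis
  proof (intro equalityI subsetI)
    fix y assume "y \<in> conj_translates G \<phi> t (\<phi> h x)"
    then obtain g where "g \<in> carrier G" "y = \<phi> (g \<otimes> t \<otimes> inv g) (\<phi> h x)"
      by (auto simp: conj_translates_def)
    then show "y \<in> \<phi> h ` conj_translates G \<phi> t x"
      using * assms(1) unfolding conj_translates_def by blast
  next
    fix y assume "y \<in> \<phi> h ` conj_translates G \<phi> t x"
    then obtain g where g: "g \<in> carrier G" "y = \<phi> h (\<phi> (g \<otimes> t \<otimes> inv g) x)"
      by (auto simp: conj_translates_def)
    moreover have "inv h \<otimes> (h \<otimes> g) = g"
      using g assms(1) by (simp flip: m_assoc)
    ultimately have "y = \<phi> ((h \<otimes> g) \<otimes> t \<otimes> inv (h \<otimes> g)) (\<phi> h x)"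
      using *[of "h \<otimes> g"] assms(1) by simp
    then show "y \<in> conj_translates G \<phi> t (\<phi> h x)"
      using g assms(1) unfolding conj_translates_def by blast
  qed
qed

lemma (in involution_action) card_conj_translates:
  assumes "x \<in> E"
  shows "card (conj_translates G \<phi> t x) = char_number G E \<phi> t"
proof -
  interpret group G
    using group_hom by (simp add: group_hom_def)
  have "card (conj_translates G \<phi> t y) = card (conj_translates G \<phi> t x)" if y: "y \<in> E" for y
  proof -
    obtain h where h: "h \<in> carrier G" "\<phi> h x = y"
      using unique_orbit[OF assms y] by blast
    have "\<phi> (g \<otimes> t \<otimes> inv g) x \<in> E" if "g \<in> carrier G" for g
      by (rule element_image[OF _ assms refl]) (use that t_closed in simp)
    then have "conj_translates G \<phi> t x \<subseteq> E"
      by (auto simp: conj_translates_def)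
    then have "inj_on (\<phi> h) (conj_translates G \<phi> t x)"
      using inj_prop[OF h(1)] inj_on_subset by blast
    then show ?thesis
      using conj_translates_move[OF h(1) assms] h(2) by (simp add: card_image)
  qed
  then have "(THE c. \<forall>y\<in>E. card (conj_translates G \<phi> t y) = c) = card (conj_translates G \<phi> t x)"
    using assms by (intro the_equality) metis+
  then show ?thesis
    by (simp add: char_number_def)
qed

section \<open>The symmetries of a square\<close>

definition square_vertices :: "complex set" where
  "square_vertices = {1, \<i>, -1, -\<i>}"

definition square_group :: "(complex \<Rightarrow> complex) monoid" where
  "square_group =
     \<lparr>carrier = {f. (\<forall>z w. dist (f z) (f w) = dist z w) \<and> f ` square_vertices = square_vertices},
      mult = (\<circ>),
      one = id\<rparr>"

text \<open>Restriction makes the permutation of the vertices extensional, as \<^const>\<open>BijGroup\<close> requires.\<close>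

definition square_action :: "(complex \<Rightarrow> complex) \<Rightarrow> complex \<Rightarrow> complex" where
  "square_action f = restrict f square_vertices"

text \<open>Every symmetry of the square fixes its centre \<open>0\<close>, so only reflections in lines through \<open>0\<close>
  matter; \<open>n\<close> is a unit normal of the line.\<close>

definition is_reflection :: "(complex \<Rightarrow> complex) \<Rightarrow> bool" where
  "is_reflection f \<longleftrightarrow> (\<exists>n. norm n = 1 \<and> f = (\<lambda>z. z - (2 * (z \<bullet> n)) *\<^sub>R n))"

lemma carrier_square_group:
  "carrier square_group =
     (\<lambda>a z. a * z) ` square_vertices \<union> (\<lambda>a z. a * cnj z) ` square_vertices"
proof (intro equalityI subsetI)
  fix f assume "f \<in> carrier square_group"
  then have iso: "dist (f z) (f w) = dist z w" and im: "f ` square_vertices = square_vertices" for z w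
    by (auto simp: square_group_def)
  have fin: "finite square_vertices"
    by (simp add: square_vertices_def)
  have inj: "inj_on f square_vertices"
    using iso by (metis dist_eq_0_iff inj_onI)
  have sum4: "(\<Sum>y\<in>square_vertices. (dist w y)\<^sup>2) = 4 * (norm w)\<^sup>2 + 4" for w :: complex
    by (simp add: square_vertices_def complex_eq_iff dist_complex_def cmod_power2)
       (simp add: power2_eq_square algebra_simps)
  have "4 * (norm (f 0))\<^sup>2 + 4 = (\<Sum>y\<in>f ` square_vertices. (dist (f 0) y)\<^sup>2)"
    by (simp only: im sum4)
  also have "\<dots> = (\<Sum>y\<in>square_vertices. (dist (f 0) (f y))\<^sup>2)"
    using inj by (simp add: sum.reindex)
  also have "\<dots> = 4"
    using sum4[of 0] by (simp only: iso) simp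
  finally have f0: "f 0 = 0"
    by simp
  then have lin: "linear f"
    using iso orthogonal_transformation_isometry orthogonal_transformation_linear by blast
  have f_eq: "f z = Re z *\<^sub>R f 1 + Im z *\<^sub>R f \<i>" for z
  proof -
    have "z = Re z *\<^sub>R 1 + Im z *\<^sub>R \<i>"
      by (simp add: complex_eq_iff)
    then show ?thesis
      using lin by (metis linear_add linear_scale)
  qed
  have 1: "f 1 \<in> square_vertices" and 2: "f \<i> \<in> square_vertices"
    using im unfolding square_vertices_def by blast+
  have d: "(dist (f \<i>) (f 1))\<^sup>2 = 2"
    unfolding iso by (simp add: dist_complex_def cmod_power2)
  have "f \<i> = \<i> * f 1 \<or> f \<i> = - \<i> * f 1"
    using 1 2 d unfolding square_vertices_def
    by (auto simp: dist_complex_def cmod_power2)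
  then show "f \<in> (\<lambda>a z. a * z) ` square_vertices \<union> (\<lambda>a z. a * cnj z) ` square_vertices"
  proof
    assume "f \<i> = \<i> * f 1"
    then have "f = (\<lambda>z. f 1 * z)"
      by (intro ext, subst f_eq) (simp add: complex_eq_iff algebra_simps)
    then show ?thesis using 1 by blast
  next
    assume "f \<i> = - \<i> * f 1"
    then have "f = (\<lambda>z. f 1 * cnj z)"
      by (intro ext, subst f_eq) (simp add: complex_eq_iff algebra_simps)
    then show ?thesis using 1 by blast
  qed
next
  fix f assume "f \<in> (\<lambda>a z. a * z) ` square_vertices \<union> (\<lambda>a z. a * cnj z) ` square_vertices"
  then obtain a where a: "a \<in> square_vertices" and f: "f = (\<lambda>z. a * z) \<or> f = (\<lambda>z. a * cnj z)"
    by blast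
  have "norm a = 1"
    using a by (auto simp: square_vertices_def)
  then have "dist (f z) (f w) = dist z w" for z w
    using f
    by (auto simp: dist_norm norm_mult simp flip: right_diff_distrib complex_cnj_diff)
  moreover have "f ` square_vertices = square_vertices"
    using a f by (auto simp: square_vertices_def)
  ultimately show "f \<in> carrier square_group"
    by (simp add: square_group_def)
qed

lemma order_square_group: "order square_group = 8"
proof -
  let ?R = "(\<lambda>a z. a * z) ` square_vertices" and ?S = "(\<lambda>a z. a * cnj z) ` square_vertices"
  have "inj_on (\<lambda>a z. a * z) square_vertices"
    by (rule inj_onI) (metis mult.right_neutral)
  moreover have "inj_on (\<lambda>a z. a * cnj z) square_vertices"
    by (rule inj_onI) (metis complex_cnj_one mult.right_neutral)
  moreover have "card square_vertices = 4"
    by (simp add: square_vertices_def complex_eq_iff)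
  moreover have "?R \<inter> ?S = {}"
  proof -
    have False if "a \<in> square_vertices" "(\<lambda>z. a * z) = (\<lambda>z. b * cnj z)" for a b
      using that(1) fun_cong[OF that(2), of 1] fun_cong[OF that(2), of \<i>]
      by (auto simp: square_vertices_def complex_eq_iff)
    then show ?thesis by blast
  qed
  moreover have "finite square_vertices"
    by (simp add: square_vertices_def)
  ultimately show ?thesis
    unfolding order_def carrier_square_group by (simp add: card_Un_disjoint card_image)
qed

lemma group_square_group: "group square_group"
proof (rule groupI)
  fix f assume f: "f \<in> carrier square_group"
  then obtain a where a: "a \<in> square_vertices" "f = (\<lambda>z. a * z) \<or> f = (\<lambda>z. a * cnj z)"
    unfolding carrier_square_group by blast
  have "cnj a \<in> square_vertices" "cnj a * a = 1"
    using a(1) by (auto simp: square_vertices_def)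
  then have "(\<lambda>z. cnj a * z) \<circ> (\<lambda>z. a * z) = id" "(\<lambda>z. a * cnj z) \<circ> (\<lambda>z. a * cnj z) = id"
    by (auto simp: fun_eq_iff mult.commute[of a] simp flip: mult.assoc)
  with a \<open>cnj a \<in> square_vertices\<close> have "\<exists>g\<in>carrier square_group. g \<circ> f = id"
    unfolding carrier_square_group by blast
  then show "\<exists>g\<in>carrier square_group. g \<otimes>\<^bsub>square_group\<^esub> f = \<one>\<^bsub>square_group\<^esub>"
    by (simp add: square_group_def)
next
  fix f g assume "f \<in> carrier square_group" "g \<in> carrier square_group"
  then show "f \<otimes>\<^bsub>square_group\<^esub> g \<in> carrier square_group"
    unfolding square_group_def by simp (metis image_comp comp_def image_cong)
qed (simp_all add: square_group_def comp_assoc)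

lemma square_action_faithful: "faithful_action square_group square_vertices square_action"
proof -
  have bij: "bij_betw f square_vertices square_vertices" if "f \<in> carrier square_group" for f
    using that unfolding square_group_def bij_betw_def
    by (auto intro!: inj_onI) (metis dist_eq_0_iff)
  then have Bij: "square_action f \<in> Bij square_vertices" if "f \<in> carrier square_group" for f
    using that unfolding square_action_def Bij_def by (auto cong: bij_betw_cong)
  have "square_action \<in> hom square_group (BijGroup square_vertices)"
  proof (rule homI)
    fix f g assume fg: "f \<in> carrier square_group" "g \<in> carrier square_group"
    have "g z \<in> square_vertices" if "z \<in> square_vertices" for z
      using bij[OF fg(2)] that bij_betwE by blast
    with Bij fg show "square_action (f \<otimes>\<^bsub>square_group\<^esub> g) =
        square_action f \<otimes>\<^bsub>BijGroup square_vertices\<^esub> square_action g"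
      by (auto simp: BijGroup_def fun_eq_iff compose_def square_action_def square_group_def)
  qed (use Bij in \<open>simp add: BijGroup_def\<close>)
  then have "group_hom square_group (BijGroup square_vertices) square_action"
    by (simp add: group_hom_def group_hom_axioms_def group_square_group group_BijGroup)
  moreover have "inj_on square_action (carrier square_group)"
  proof (rule inj_onI)
    fix f g assume fg: "f \<in> carrier square_group" "g \<in> carrier square_group"
      and "square_action f = square_action g"
    then have "f 1 = g 1" "f \<i> = g \<i>"
      by (auto simp: square_action_def square_vertices_def fun_eq_iff restrict_def split: if_splits)
    have eq: "h z = Re z *\<^sub>R h 1 + Im z *\<^sub>R h \<i>" if "h \<in> carrier square_group" for h z
      using that unfolding carrier_square_group by (auto simp: complex_eq_iff algebra_simps)
    show "f = g"
      using eq fg \<open>f 1 = g 1\<close> \<open>f \<i> = g \<i>\<close> by (metis ext)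
  qed
  ultimately show ?thesis
    by (simp add: faithful_action_def faithful_action_axioms_def group_action_def)
qed

lemma square_action_transitive: "transitive_action square_group square_vertices square_action"
proof -
  have "\<exists>f\<in>carrier square_group. square_action f x = y"
    if "x \<in> square_vertices" "y \<in> square_vertices" for x y
  proof
    have "y * cnj x \<in> square_vertices" "cnj x * x = 1"
      using that by (auto simp: square_vertices_def)
    then show "(\<lambda>z. y * cnj x * z) \<in> carrier square_group"
      unfolding carrier_square_group by blast
    show "square_action (\<lambda>z. y * cnj x * z) x = y"
      using that \<open>cnj x * x = 1\<close> by (simp add: square_action_def mult.assoc)
  qed
  then show ?thesis
    using square_action_faithful
    by (simp add: faithful_action_def transitive_action_def transitive_action_axioms_def)
qed

lemma vertex_free_reflections:
  "{t \<in> carrier square_group. is_reflection t \<and> invariants square_vertices square_action t = {}} =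
     {\<lambda>z. \<i> * cnj z, \<lambda>z. - \<i> * cnj z}" (is "?L = ?R")
proof (intro equalityI subsetI)
  fix t assume t: "t \<in> ?L"
  then obtain n where n: "norm n = 1" "t = (\<lambda>z. z - (2 * (z \<bullet> n)) *\<^sub>R n)"
    by (auto simp: is_reflection_def)
  obtain a where a: "a \<in> square_vertices" "t = (\<lambda>z. a * z) \<or> t = (\<lambda>z. a * cnj z)"
    using t unfolding carrier_square_group by blast
  have "t n = - n"
    using n by (simp add: dot_square_norm scaleR_2)
  moreover have "t (\<i> * n) = \<i> * n"
    using n by (simp add: inner_complex_def)
  ultimately have "t \<noteq> (\<lambda>z. a * z)"
    using n(1) by (auto simp: mult.left_commute)
  with a have t_eq: "t = (\<lambda>z. a * cnj z)"
    by simp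
  have "t y \<noteq> y" if "y \<in> square_vertices" for y
    using t that by (auto simp: invariants_def square_action_def)
  from this[of 1] this[of \<i>] have "a \<noteq> 1" "a \<noteq> -1"
    unfolding t_eq by (auto simp: square_vertices_def)
  then show "t \<in> ?R"
    using a(1) t_eq by (auto simp: square_vertices_def)
next
  fix t assume t: "t \<in> ?R"
  then obtain s :: real where s: "s = 1 \<or> s = -1" "t = (\<lambda>z. s * \<i> * cnj z)"
    by (auto intro: that[of 1] that[of "-1"])
  define c :: real where "c = 1 / sqrt 2"
  have c: "c * c = 1 / 2" "s * s = 1"
    using s(1) by (auto simp: c_def)
  define n where "n = Complex c (- s * c)"
  have "norm n = 1"
    using c by (simp add: n_def norm_complex_def power2_eq_square algebra_simps)
  moreover have "t = (\<lambda>z. z - (2 * (z \<bullet> n)) *\<^sub>R n)"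
  proof
    fix z
    have *: "2 * (x * c + y * (- (s * c))) * c = x - s * y"
      "2 * (x * c + y * (- (s * c))) * (s * c) = s * x - y" for x y
    proof -
      have "2 * (x * c + y * (- (s * c))) * c = 2 * (c * c) * (x - s * y)"
        by (simp add: algebra_simps)
      then show 1: "2 * (x * c + y * (- (s * c))) * c = x - s * y"
        using c by simp
      have "2 * (x * c + y * (- (s * c))) * (s * c) = s * (2 * (x * c + y * (- (s * c))) * c)"
        by (simp only: ac_simps)
      also have "\<dots> = s * x - (s * s) * y"
        unfolding 1 by (simp add: algebra_simps)
      finally show "2 * (x * c + y * (- (s * c))) * (s * c) = s * x - y"
        using c by simp
    qed
    show "t z = z - (2 * (z \<bullet> n)) *\<^sub>R n"
      using *[of "Re z" "Im z"] by (simp add: s n_def complex_eq_iff inner_complex_def)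
  qed
  moreover have "t \<in> carrier square_group"
    using t unfolding carrier_square_group square_vertices_def by blast
  moreover have "invariants square_vertices square_action t = {}"
    using t by (auto simp: invariants_def square_action_def square_vertices_def complex_eq_iff)
  ultimately show "t \<in> ?L"
    by (auto simp: is_reflection_def)
qed

lemma square_involution_action:
  assumes "t \<in> carrier square_group" "is_reflection t"
    and "invariants square_vertices square_action t = {}"
  shows "involution_action square_group square_vertices square_action t"
proof -
  have "t \<in> {\<lambda>z. \<i> * cnj z, \<lambda>z. - \<i> * cnj z}"
    using assms vertex_free_reflections by blast
  then have "t \<noteq> \<one>\<^bsub>square_group\<^esub>" "t \<otimes>\<^bsub>square_group\<^esub> t = \<one>\<^bsub>square_group\<^esub>"
    by (auto simp: square_group_def fun_eq_iff complex_eq_iff intro: exI[of _ 1])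
  moreover have "finite (carrier square_group)" "finite square_vertices"
    by (simp_all add: carrier_square_group square_vertices_def)
  ultimately show ?thesis
    using assms square_action_faithful square_action_transitive
    by (simp add: involution_action_def involution_action_axioms_def)
qed

section \<open>Number fields\<close>

text \<open>A number field is a type of class \<^class>\<open>field_char_0\<close> of finite nonzero dimension over the
  rationals. The value of \<open>degree_over_Q\<close> is \<open>0\<close> if the extension is infinite.\<close>

definition degree_over_Q :: "'k::field_char_0 itself \<Rightarrow> nat" where
  "degree_over_Q _ = vector_space.dim (\<lambda>(q::rat) (x::'k). of_rat q * x) UNIV"

definition embeddings :: "('k::field_char_0 \<Rightarrow> complex) set" where
  "embeddings = ring_hom ring_of_type_algebra ring_of_type_algebra"

definition totally_imaginary :: "'k::field_char_0 itself \<Rightarrow> bool" where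
  "totally_imaginary _ \<longleftrightarrow> (\<forall>\<sigma> \<in> (embeddings :: ('k \<Rightarrow> complex) set). \<not> range \<sigma> \<subseteq> \<real>)"

text \<open>The Galois hull, realized inside \<open>\<complex>\<close> as the compositum of all conjugates of the field.\<close>

definition galois_hull :: "'k::field_char_0 itself \<Rightarrow> complex set" where
  "galois_hull _ =
     generate_field ring_of_type_algebra (\<Union>\<sigma> \<in> (embeddings :: ('k \<Rightarrow> complex) set). range \<sigma>)"

text \<open>The group of automorphisms over the rationals of a subfield \<open>L\<close> of \<open>\<complex>\<close>.\<close>

definition galois_group :: "complex set \<Rightarrow> (complex \<Rightarrow> complex) monoid" where
  "galois_group L = BijGroup L
     \<lparr>carrier := {\<sigma> \<in> Bij L.
        \<sigma> \<in> ring_hom (ring_of_type_algebra\<lparr>carrier := L\<rparr>) (ring_of_type_algebra\<lparr>carrier := L\<rparr>) \<and>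
        (\<forall>q\<in>\<rat>. \<sigma> q = q)}\<rparr>"

section \<open>Forms in three variables\<close>

text \<open>The polynomial ring \<open>R[x\<^sub>1,x\<^sub>2,x\<^sub>3]\<close> as the monoid algebra of the monoid of exponent vectors;
  the variables are indexed by the three-element type \<^typ>\<open>3\<close>.\<close>

type_synonym 'a poly3 = "(3 \<Rightarrow>\<^sub>0 nat) \<Rightarrow>\<^sub>0 'a"

definition linear_form :: "'a::comm_ring_1 poly3 \<Rightarrow> bool" where
  "linear_form l \<longleftrightarrow>
     (\<exists>a. l = (\<Sum>i\<in>UNIV. Poly_Mapping.single (Poly_Mapping.single i 1) (a i)))"

definition norm_form :: "'k::field_char_0 poly3 \<Rightarrow> complex poly3" where
  "norm_form l = (\<Prod>\<sigma>\<in>embeddings. Poly_Mapping.map \<sigma> l)"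

definition sum_of_squares :: "'a::comm_ring_1 poly3 \<Rightarrow> bool" where
  "sum_of_squares f \<longleftrightarrow> (\<exists>gs. f = (\<Sum>g\<leftarrow>gs. g\<^sup>2))"

end

theory Submission
  imports Defs
begin

text \<open>Let \<open>z\<close> be the central involution of the Galois group. If \<open>z (\<sigma> x)\<close> were outside \<open>\<sigma>(K)\<close>, some
  automorphism \<open>g\<close> fixing \<open>\<sigma>(K)\<close> pointwise would move it, contradicting \<open>g z = z g\<close>; so \<open>z\<close> induces an
  involution of \<open>K\<close>. Its fixed field is quadratic, \<open>F = \<rat>(\<surd>d)\<close>, and \<open>K = F(\<surd>b)\<close>. The relative norm of
  \<open>l\<close> is \<open>A + B \<surd>d\<close> with rational forms \<open>A, B\<close>, whence \<open>f = A\<^sup>2 - d B\<^sup>2\<close>, which settles \<open>d < 0\<close>. If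
  \<open>d > 0\<close>, then \<open>a = - b\<close> is totally positive, the relative norm is \<open>u\<^sup>2 + a v\<^sup>2\<close>, and with \<open>'\<close> denoting
  conjugation of \<open>F\<close> the norm is \<open>(u u')\<^sup>2 + a a' (v v')\<^sup>2 + Tr (a (u' v)\<^sup>2)\<close>, where the trace is a
  positive definite binary form over \<open>\<rat>\<close>.\<close>

text \<open>The Galois group is given only up to an abstract isomorphism, so what is drawn from it
  must be intrinsic: the half turn, the nontrivial central element of \<open>square_group\<close>. K
  is not normal over the rationals, and a general automorphism of the hull does not preserve
  \<sigma>(K). Showing that z does takes enough automorphisms, hence the extension theorem for
  homomorphisms into an algebraically closed field. The sign of d records how complex conjugation
  acts on the four embeddings. For d < 0 it exchanges the two pairs of embeddings that agree on F,
  as a reflection without fixed vertices does; this is the case of characteristic number 2. For d >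
  0 it preserves the pairs and, K having no real embedding, swaps the members of each, like the half
  turn; so b is negative under both real embeddings of F. The identity for d > 0 comes from
  expanding (u^2 + a v^2)(u'^2 + a' v'^2): the mixed terms a (u' v)^2 and a' (u v')^2 are conjugate,
  so their sum is a trace.\<close>

hide_const (open) up_ring.coeff up_ring.monom Polynomials.degree


section \<open>Extension of field homomorphisms\<close>

text \<open>Partial field homomorphisms are handled through their graphs, so that extending one is a matter of
  inclusion; \<open>pols\<close> below consists of the polynomials over the domain paired with their images.\<close>

locale field_graph =
  fixes \<Gamma> :: "('a::field \<times> 'b::field) set"
  assumes one: "(1, 1) \<in> \<Gamma>"
    and add: "(x, y) \<in> \<Gamma> \<Longrightarrow> (x', y') \<in> \<Gamma> \<Longrightarrow> (x + x', y + y') \<in> \<Gamma>"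
    and mult: "(x, y) \<in> \<Gamma> \<Longrightarrow> (x', y') \<in> \<Gamma> \<Longrightarrow> (x * x', y * y') \<in> \<Gamma>"
    and uminus: "(x, y) \<in> \<Gamma> \<Longrightarrow> (- x, - y) \<in> \<Gamma>"
    and inverse: "(x, y) \<in> \<Gamma> \<Longrightarrow> (inverse x, inverse y) \<in> \<Gamma>"
    and zero_fst: "(0, y) \<in> \<Gamma> \<Longrightarrow> y = 0"
begin

lemma zero: "(0, 0) \<in> \<Gamma>"
  using add[OF one uminus[OF one]] by simp

lemma diff: "(x, y) \<in> \<Gamma> \<Longrightarrow> (x', y') \<in> \<Gamma> \<Longrightarrow> (x - x', y - y') \<in> \<Gamma>"
  using add[OF _ uminus] by fastforce

text \<open>Injectivity is automatic, as for any homomorphism of fields: closure under inverses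
  turns a nonzero x over 0 into the pair (1, 0), which conflicts with (1, 1).\<close>

lemma zero_snd:
  assumes "(x, 0) \<in> \<Gamma>"
  shows "x = 0"
proof (rule ccontr)
  assume "x \<noteq> 0"
  then have "(1, 0) \<in> \<Gamma>"
    using mult[OF assms inverse[OF assms]] by simp
  then show False
    using diff[OF one, of 1 0] zero_fst by fastforce
qed

lemma unique: "(x, y) \<in> \<Gamma> \<Longrightarrow> (x, y') \<in> \<Gamma> \<Longrightarrow> y = y'"
  using diff[of x y x y'] zero_fst by fastforce

lemma sum:
  assumes "\<And>i. i \<in> I \<Longrightarrow> (f i, g i) \<in> \<Gamma>"
  shows "(sum f I, sum g I) \<in> \<Gamma>"
  using assms by (induction I rule: infinite_finite_induct) (auto intro: zero add)

lemma of_nat: "(of_nat n, of_nat n) \<in> \<Gamma>"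
  by (induction n) (auto intro: zero add one)

lemma of_int: "(of_int n, of_int n) \<in> \<Gamma>"
  by (cases n rule: int_cases2) (use of_nat uminus in auto)

section \<open>Polynomials with corresponding coefficients\<close>

definition pols :: "('a poly \<times> 'b poly) set" where
  "pols = {(p, q). \<forall>i. (coeff p i, coeff q i) \<in> \<Gamma>}"

lemma pols_coeff: "(p, q) \<in> pols \<Longrightarrow> (coeff p i, coeff q i) \<in> \<Gamma>"
  by (simp add: pols_def)

lemma pols_zero: "(0, 0) \<in> pols"
  by (simp add: pols_def zero)

lemma pols_monom: "(x, y) \<in> \<Gamma> \<Longrightarrow> (monom x n, monom y n) \<in> pols"
  by (auto simp: pols_def zero)

lemma pols_const: "(x, y) \<in> \<Gamma> \<Longrightarrow> ([:x:], [:y:]) \<in> pols"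
  using pols_monom[of x y 0] by (simp add: monom_0)

lemma pols_add: "(p, q) \<in> pols \<Longrightarrow> (p', q') \<in> pols \<Longrightarrow> (p + p', q + q') \<in> pols"
  by (auto simp: pols_def add)

lemma pols_uminus: "(p, q) \<in> pols \<Longrightarrow> (- p, - q) \<in> pols"
  by (auto simp: pols_def uminus)

lemma pols_diff: "(p, q) \<in> pols \<Longrightarrow> (p', q') \<in> pols \<Longrightarrow> (p - p', q - q') \<in> pols"
  by (auto simp: pols_def diff)

lemma pols_mult: "(p, q) \<in> pols \<Longrightarrow> (p', q') \<in> pols \<Longrightarrow> (p * p', q * q') \<in> pols"
  by (auto simp: pols_def coeff_mult intro!: sum mult)

lemma pols_zero_fst: "(0, q) \<in> pols \<Longrightarrow> q = 0"
  by (auto simp: pols_def poly_eq_iff intro: zero_fst)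

lemma pols_degree:
  assumes "(p, q) \<in> pols"
  shows "degree q = degree p"
proof -
  have *: "coeff p i = 0 \<longleftrightarrow> coeff q i = 0" for i
    using pols_coeff[OF assms, of i] zero_fst zero_snd by metis
  show ?thesis
  proof (rule antisym)
    show "degree q \<le> degree p"
      by (rule degree_le) (simp add: coeff_eq_0 flip: *)
    show "degree p \<le> degree q"
      by (rule degree_le) (simp add: coeff_eq_0 *)
  qed
qed

text \<open>Long division is run on both components in parallel. The first component governs
  termination; the second follows because each new quotient coefficient is again a pair of the
  graph.\<close>

lemma pols_division:
  assumes p: "(p, q) \<in> pols" "p \<noteq> 0" and a: "(a, b) \<in> pols"
  obtains k k' r r' where "(k, k') \<in> pols" "(r, r') \<in> pols" "a = p * k + r" "b = q * k' + r'"
    "r = 0 \<or> degree r < degree p"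
proof -
  have "\<exists>k k' r r'. (k, k') \<in> pols \<and> (r, r') \<in> pols \<and> a = p * k + r \<and> b = q * k' + r' \<and>
      (r = 0 \<or> degree r < degree p)"
    using a
  proof (induction "degree a" arbitrary: a b rule: less_induct)
    case less
    show ?case
    proof (cases "a = 0 \<or> degree a < degree p")
      case True
      then show ?thesis
        using less.prems pols_zero by (metis add_0 mult_zero_right)
    next
      case False
      define n where "n = degree a - degree p"
      define c where "c = coeff a (degree a) * inverse (coeff p (degree p))"
      \<comment> \<open>Both leading coefficients are read off at the degrees of the first
        components, so that \<open>(c, c')\<close> is built from pairs in the graph.\<close>
      define c' where "c' = coeff b (degree a) * inverse (coeff q (degree p))"
      have cc: "(monom c n, monom c' n) \<in> pols"
        unfolding c_def c'_def by (intro pols_monom mult inverse pols_coeff p less.prems)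
      have new: "(a - p * monom c n, b - q * monom c' n) \<in> pols"
        by (intro pols_diff pols_mult less.prems p cc)
      have le: "degree (a - p * monom c n) \<le> degree a"
      proof (rule degree_diff_le)
        show "degree (p * monom c n) \<le> degree a"
          using False degree_mult_le[of p "monom c n"] degree_monom_le[of c n]
          unfolding n_def by linarith
      qed simp
      have lc: "coeff (a - p * monom c n) (degree a) = 0"
        using False p(2) by (simp add: mult.commute[of p] coeff_monom_mult n_def c_def)
      show ?thesis
      proof (cases "a - p * monom c n = 0")
        case True
        then have "b - q * monom c' n = 0"
          using pols_zero_fst new True by presburger
        with True cc pols_zero show ?thesis
          by (intro exI[of _ "monom c n"] exI[of _ "monom c' n"] exI[of _ 0]) simp
      next
        case nz: False
        have "degree (a - p * monom c n) < degree a"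
          using le lc nz by (metis le_neq_implies_less leading_coeff_0_iff)
        from less.hyps[OF this new] obtain k k' r r' where *: "(k, k') \<in> pols" "(r, r') \<in> pols"
          "a - p * monom c n = p * k + r" "b - q * monom c' n = q * k' + r'"
          "r = 0 \<or> degree r < degree p"
          by blast
        then have "a = p * (k + monom c n) + r" "b = q * (k' + monom c' n) + r'"
          by (auto simp: algebra_simps)
        then show ?thesis
          using * pols_add[OF *(1) cc] by blast
      qed
    qed
  qed
  then show ?thesis
    using that by blast
qed

end

text \<open>\<open>(m, m')\<close> is a minimal polynomial of \<open>y\<close> over the domain of \<open>\<Gamma>\<close> together with its image, of
  which \<open>\<beta>\<close> is a root.\<close>

locale field_graph_minpoly = field_graph \<Gamma>
  for \<Gamma> :: "('a::field \<times> 'b::field) set" +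
  fixes m m' y \<beta>
  assumes m: "(m, m') \<in> pols" "m \<noteq> 0" "poly m y = 0"
    and minimal: "(p, q) \<in> pols \<Longrightarrow> poly p y = 0 \<Longrightarrow> p \<noteq> 0 \<Longrightarrow> degree m \<le> degree p"
    and root: "poly m' \<beta> = 0"
begin

text \<open>Division by \<open>(m, m')\<close> leaves a remainder vanishing at y, which is zero by
  minimality and then has zero image. Hence sending \<open>poly p y\<close> to
  \<open>poly q \<beta>\<close> does not depend on the choice of p.\<close>

lemma well_defined:
  assumes "(p, q) \<in> pols" "poly p y = 0"
  shows "poly q \<beta> = 0"
proof -
  obtain k k' r r' where *: "(k, k') \<in> pols" "(r, r') \<in> pols" "p = m * k + r" "q = m' * k' + r'"
    "r = 0 \<or> degree r < degree m"
    using pols_division[OF m(1,2) assms(1)] by blast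
  have "poly r y = 0"
    using assms(2) m(3) *(3) by simp
  then have "r = 0"
    using minimal[OF *(2)] *(5) by force
  then have "r' = 0"
    using *(2) pols_zero_fst by simp
  then show ?thesis
    using *(4) root by simp
qed

text \<open>A Euclidean descent: m = p k + r gives p(y) k(y) = - r(y), and r has smaller degree, so
  an inverse of r(y) yields one of p(y). If r(y) = 0, then k(y) = 0, minimality gives k at least the
  degree of m, and p is a constant.\<close>

lemma ex_inverse_of_small_degree:
  assumes "(p, q) \<in> pols" "poly p y \<noteq> 0" "degree p < degree m"
  shows "\<exists>k k'. (k, k') \<in> pols \<and> poly p y * poly k y = 1"
  using assms
proof (induction "degree p" arbitrary: p q rule: less_induct)
  case less
  have p0: "p \<noteq> 0"
    using less.prems by auto
  obtain k k' r r' where *: "(k, k') \<in> pols" "(r, r') \<in> pols" "m = p * k + r"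
    "r = 0 \<or> degree r < degree p"
    using pols_division[OF less.prems(1) p0 m(1)] by metis
  have r: "poly r y = - poly p y * poly k y"
    using m(3) *(3) by (simp add: add_eq_0_iff)
  show ?case
  proof (cases "poly r y = 0")
    case False
    then obtain w w' where w: "(w, w') \<in> pols" "poly r y * poly w y = 1"
      using less.hyps[OF _ *(2)] *(4) less.prems(3) by auto
    have "poly p y * poly (- (k * w)) y = 1"
      using w(2) r by (simp add: mult.assoc)
    then show ?thesis
      using pols_uminus[OF pols_mult[OF *(1) w(1)]] by blast
  next
    case True
    then have "poly k y = 0"
      using r less.prems(2) by simp
    moreover have k0: "k \<noteq> 0"
      using * less.prems(3) m(2) by auto
    ultimately have "degree m \<le> degree k"
      using minimal *(1) by blast
    moreover have "degree p + degree k = degree (m - r)"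
      using *(3) p0 k0 by (simp add: degree_mult_eq)
    moreover have "degree (m - r) \<le> degree m"
      using *(4) less.prems(3) by (intro degree_diff_le) auto
    ultimately have "degree p = 0"
      by simp
    then obtain c where c: "p = [:c:]"
      by (metis degree_eq_zeroE)
    then have "(c, coeff q 0) \<in> \<Gamma>"
      using pols_coeff[OF less.prems(1), of 0] by simp
    then have "([:inverse c:], [:inverse (coeff q 0):]) \<in> pols"
      by (intro pols_const inverse)
    moreover have "poly p y * poly [:inverse c:] y = 1"
      using c p0 by simp
    ultimately show ?thesis
      by blast
  qed
qed

lemma ex_inverse:
  assumes "(p, q) \<in> pols" "poly p y \<noteq> 0"
  shows "\<exists>k k'. (k, k') \<in> pols \<and> poly p y * poly k y = 1"
proof -
  obtain k k' r r' where *: "(k, k') \<in> pols" "(r, r') \<in> pols" "p = m * k + r"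
    "r = 0 \<or> degree r < degree m"
    using pols_division[OF m(1,2) assms(1)] by metis
  have "poly r y = poly p y"
    using *(3) m(3) by simp
  then show ?thesis
    using ex_inverse_of_small_degree[OF *(2)] *(4) assms(2) by auto
qed

text \<open>As y is algebraic over the domain, polynomial values already form a field, so no
  quotients have to be taken.\<close>

definition adjoin :: "('a \<times> 'b) set" where
  "adjoin = {(poly p y, poly q \<beta>) | p q. (p, q) \<in> pols}"

lemma adjoinI: "(p, q) \<in> pols \<Longrightarrow> (poly p y, poly q \<beta>) \<in> adjoin"
  by (auto simp: adjoin_def)

lemma subset_adjoin: "\<Gamma> \<subseteq> adjoin"
proof
  fix z assume "z \<in> \<Gamma>"
  then show "z \<in> adjoin"
    using adjoinI[OF pols_const, of "fst z" "snd z"] by simp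
qed

lemma new_in_adjoin: "(y, \<beta>) \<in> adjoin"
  using adjoinI[OF pols_monom[OF one], of 1] by (simp add: poly_monom)

lemma field_graph_adjoin: "field_graph adjoin"
proof
  show "(1, 1) \<in> adjoin"
    using one subset_adjoin by blast
next
  fix x x' z z' assume "(x, z) \<in> adjoin" "(x', z') \<in> adjoin"
  then obtain p q p' q' where *: "(p, q) \<in> pols" "(p', q') \<in> pols"
    "x = poly p y" "z = poly q \<beta>" "x' = poly p' y" "z' = poly q' \<beta>"
    unfolding adjoin_def by blast
  show "(x + x', z + z') \<in> adjoin"
    using adjoinI[OF pols_add[OF *(1,2)]] by (simp add: *)
  show "(x * x', z * z') \<in> adjoin"
    using adjoinI[OF pols_mult[OF *(1,2)]] by (simp add: *)
next
  fix x z assume "(x, z) \<in> adjoin"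
  then obtain p q where *: "(p, q) \<in> pols" "x = poly p y" "z = poly q \<beta>"
    unfolding adjoin_def by blast
  show "(- x, - z) \<in> adjoin"
    using adjoinI[OF pols_uminus[OF *(1)]] by (simp add: *)
  show "(inverse x, inverse z) \<in> adjoin"
  proof (cases "x = 0")
    case True
    then have "z = 0"
      using well_defined * by simp
    then show ?thesis
      using True zero subset_adjoin by auto
  next
    case False
    then obtain k k' where k: "(k, k') \<in> pols" "x * poly k y = 1"
      using ex_inverse * by blast
    \<comment> \<open>The relation x * k(y) = 1 is itself the vanishing of a polynomial at y, so
      \<open>well_defined\<close> carries it over to \<beta>.\<close>
    have "(p * k - 1, q * k' - 1) \<in> pols"
      using pols_diff[OF pols_mult[OF *(1) k(1)] pols_const[OF one]] by (simp add: one_pCons)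
    from well_defined[OF this] have "z * poly k' \<beta> = 1"
      using k(2) * by simp
    then have "inverse x = poly k y" "inverse z = poly k' \<beta>"
      using k(2) by (auto intro: inverse_unique)
    then show ?thesis
      using adjoinI[OF k(1)] by simp
  qed
next
  fix z assume "(0, z) \<in> adjoin"
  then show "z = 0"
    unfolding adjoin_def using well_defined by fastforce
qed

end

lemma (in field_graph) ex_minpoly:
  assumes "(p, q) \<in> pols" "p \<noteq> 0" "poly p y = 0"
  obtains m m' where "(m, m') \<in> pols" "m \<noteq> 0" "poly m y = 0"
    "\<And>p q. (p, q) \<in> pols \<Longrightarrow> poly p y = 0 \<Longrightarrow> p \<noteq> 0 \<Longrightarrow> degree m \<le> degree p"
proof -
  define P where "P m \<longleftrightarrow> (\<exists>m'. (m, m') \<in> pols) \<and> m \<noteq> 0 \<and> poly m y = 0" for m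
  have "P p"
    using assms by (auto simp: P_def)
  then obtain m where m: "P m" and least: "\<And>p. P p \<Longrightarrow> degree m \<le> degree p"
    using ex_has_least_nat[of P p degree] by blast
  from m obtain m' where "(m, m') \<in> pols" "m \<noteq> 0" "poly m y = 0"
    by (auto simp: P_def)
  then show ?thesis
    using that least unfolding P_def by blast
qed

lemma degree_pos_of_root:
  fixes p :: "'a::comm_ring_1 poly"
  assumes "p \<noteq> 0" "poly p y = 0"
  shows "degree p > 0"
proof (rule ccontr)
  assume "\<not> degree p > 0"
  then obtain c where "p = [:c:]"
    by (auto elim: degree_eq_zeroE)
  then show False
    using assms by simp
qed

text \<open>Every closure condition involves at most two pairs, and two pairs from a chain lie in a
  common member.\<close>

lemma field_graph_Union_chain:
  assumes "C \<noteq> {}" "subset.chain (Collect field_graph) C"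
  shows "field_graph (\<Union>C)"
proof
  have fg: "field_graph \<Gamma>" if "\<Gamma> \<in> C" for \<Gamma>
    using assms(2) that by (auto simp: subset.chain_def)
  have common: "\<exists>\<Gamma>\<in>C. u \<in> \<Gamma> \<and> v \<in> \<Gamma>" if "u \<in> \<Union>C" "v \<in> \<Union>C" for u v
  proof -
    obtain \<Gamma> \<Gamma>' where "\<Gamma> \<in> C" "u \<in> \<Gamma>" "\<Gamma>' \<in> C" "v \<in> \<Gamma>'"
      using \<open>u \<in> \<Union>C\<close> \<open>v \<in> \<Union>C\<close> by blast
    moreover from this have "\<Gamma> \<subseteq> \<Gamma>' \<or> \<Gamma>' \<subseteq> \<Gamma>"
      using assms(2) by (simp add: subset_chain_def)
    ultimately show ?thesis
      by blast
  qed
  show "(1, 1) \<in> \<Union>C"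
    using assms(1) fg field_graph.one by blast
  show "(x + x', y + y') \<in> \<Union>C" "(x * x', y * y') \<in> \<Union>C"
    if "(x, y) \<in> \<Union>C" "(x', y') \<in> \<Union>C" for x y x' y'
    using common[OF that] field_graph.add[OF fg] field_graph.mult[OF fg] by blast+
  show "(- x, - y) \<in> \<Union>C" "(inverse x, inverse y) \<in> \<Union>C" if "(x, y) \<in> \<Union>C" for x y
    using that field_graph.uminus[OF fg] field_graph.inverse[OF fg] by blast+
  show "y = 0" if "(0, y) \<in> \<Union>C" for y
    using that field_graph.zero_fst[OF fg] by blast
qed

text \<open>Take M maximal by Zorn's lemma. An algebraic element y outside its domain could be
  adjoined by sending it to a root of the image of its minimal polynomial, and the algebraically
  closed codomain provides such a root.\<close>

theorem extend_field_graph: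
  fixes \<Gamma> :: "('a::field \<times> 'b::alg_closed_field) set"
  assumes "field_graph \<Gamma>"
  obtains M where "field_graph M" "\<Gamma> \<subseteq> M"
    "\<And>p q y. (p, q) \<in> field_graph.pols M \<Longrightarrow> p \<noteq> 0 \<Longrightarrow> poly p y = 0 \<Longrightarrow> y \<in> Domain M"
proof -
  define A where "A = {N. field_graph N \<and> \<Gamma> \<subseteq> N}"
  have "\<exists>M\<in>A. \<forall>N\<in>A. M \<subseteq> N \<longrightarrow> N = M"
  proof (rule subset_Zorn_nonempty)
    fix C assume chain: "C \<noteq> {}" "subset.chain A C"
    have "field_graph (\<Union>C)"
      using chain by (intro field_graph_Union_chain) (auto simp: subset.chain_def A_def)
    moreover obtain N where "N \<in> C" "N \<in> A"
      using chain by (auto simp: subset.chain_def)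
    then have "\<Gamma> \<subseteq> \<Union>C"
      by (auto simp: A_def)
    ultimately show "\<Union>C \<in> A"
      by (simp add: A_def)
  qed (use assms in \<open>auto simp: A_def\<close>)
  then obtain M where "M \<in> A" and maxA: "\<forall>N\<in>A. M \<subseteq> N \<longrightarrow> N = M"
    by (elim bexE)
  then have M: "field_graph M" "\<Gamma> \<subseteq> M"
    by (simp_all add: A_def)
  have max: "N = M" if "field_graph N" "M \<subseteq> N" for N
    using maxA that M(2) by (simp add: A_def)
  interpret field_graph M by fact
  have "y \<in> Domain M" if p: "(p, q) \<in> pols" "p \<noteq> 0" "poly p y = 0" for p q y
  proof -
    obtain m m' where m: "(m, m') \<in> pols" "m \<noteq> 0" "poly m y = 0"
      "\<And>p q. (p, q) \<in> pols \<Longrightarrow> poly p y = 0 \<Longrightarrow> p \<noteq> 0 \<Longrightarrow> degree m \<le> degree p"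
      using ex_minpoly[OF p] by blast
    have "degree m > 0"
      using m degree_pos_of_root by blast
    then have "degree m' > 0"
      using pols_degree[OF m(1)] by simp
    then obtain \<beta> where "poly m' \<beta> = 0"
      using alg_closed_imp_poly_has_root by blast
    then interpret field_graph_minpoly M m m' y \<beta>
      using m by unfold_locales
    show ?thesis
      using max[OF field_graph_adjoin subset_adjoin] new_in_adjoin by blast
  qed
  then show ?thesis
    by (rule that[OF M])
qed

section \<open>Field embeddings and rational polynomials\<close>

locale field_emb =
  fixes \<sigma> :: "'a::field_char_0 \<Rightarrow> 'b::field_char_0"
  assumes add: "\<sigma> (x + y) = \<sigma> x + \<sigma> y"
    and mult: "\<sigma> (x * y) = \<sigma> x * \<sigma> y"
    and one: "\<sigma> 1 = 1"
begin

lemma zero: "\<sigma> 0 = 0"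
  using add[of 0 0] by simp

lemma uminus: "\<sigma> (- x) = - \<sigma> x"
  using add[of x "- x"] by (simp add: zero minus_unique)

lemma diff: "\<sigma> (x - y) = \<sigma> x - \<sigma> y"
  using add[of x "- y"] by (simp add: uminus)

lemma power: "\<sigma> (x ^ n) = \<sigma> x ^ n"
  by (induction n) (auto simp: one mult)

lemma eq_zero_iff: "\<sigma> x = 0 \<longleftrightarrow> x = 0"
proof
  assume "\<sigma> x = 0"
  then have "\<sigma> (x * inverse x) = 0"
    by (simp add: mult)
  then show "x = 0"
    using one by (cases "x = 0") auto
qed (simp add: zero)

lemma eq_iff: "\<sigma> x = \<sigma> y \<longleftrightarrow> x = y"
  using eq_zero_iff[of "x - y"] by (simp add: diff)

lemma inverse: "\<sigma> (inverse x) = inverse (\<sigma> x)"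
proof (cases "x = 0")
  case False
  then have "\<sigma> x * \<sigma> (inverse x) = 1"
    by (simp add: one flip: mult)
  then show ?thesis
    by (simp add: inverse_unique)
qed (simp add: zero)

lemma of_nat: "\<sigma> (of_nat n) = of_nat n"
  by (induction n) (auto simp: zero one add)

lemma of_int: "\<sigma> (of_int n) = of_int n"
  by (cases n rule: int_cases2) (auto simp: of_nat uminus)

lemma of_rat: "\<sigma> (of_rat q) = of_rat q"
  by (cases q) (simp add: of_rat_rat divide_inverse mult inverse of_int)

lemma rat_poly_image:
  assumes "poly (map_poly of_rat p) x = 0"
  shows "poly (map_poly of_rat p) (\<sigma> x) = 0"
proof -
  have "poly (map_poly of_rat p) (\<sigma> x) = \<sigma> (poly (map_poly of_rat p) x)"
    by (induction p) (auto simp: map_poly_pCons zero of_rat add mult)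
  then show ?thesis
    by (simp add: assms zero)
qed

text \<open>A subfield is expressed as the graph of its identity map, so that extending the identity
  of a subfield is a case of extending a graph.\<close>

lemma field_graph_range: "field_graph (Id_on (range \<sigma>))"
proof
  show "(1, 1) \<in> Id_on (range \<sigma>)"
    using one by (metis Id_on_iff rangeI)
qed (auto simp: Id_on_iff simp flip: add mult uminus inverse)

end

lemma field_emb_of_rat: "field_emb (of_rat :: rat \<Rightarrow> 'a::field_char_0)"
  by unfold_locales (simp_all add: of_rat_add of_rat_mult)

lemma embeddings_iff: "\<sigma> \<in> embeddings \<longleftrightarrow> field_emb \<sigma>"
  by (auto simp: embeddings_def ring_hom_def ring_of_type_algebra_def field_emb_def)

lemma (in field_graph) pols_poly:
  assumes "(p, q) \<in> pols" "(x, y) \<in> \<Gamma>"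
  shows "(poly p x, poly q y) \<in> \<Gamma>"
proof -
  have "(x ^ i, y ^ i) \<in> \<Gamma>" for i
    by (induction i) (auto intro: one mult assms)
  then show ?thesis
    unfolding poly_altdef pols_degree[OF assms(1)]
    by (intro sum mult pols_coeff[OF assms(1)])
qed

definition algebraic_over_Q :: "'k::field_char_0 itself \<Rightarrow> bool" where
  "algebraic_over_Q _ \<longleftrightarrow> (\<forall>x::'k. \<exists>p::rat poly. p \<noteq> 0 \<and> poly (map_poly of_rat p) x = 0)"

lemma field_graph_of_rat_mem:
  fixes \<Gamma> :: "('a::field_char_0 \<times> 'b::field_char_0) set"
  assumes "field_graph \<Gamma>"
  shows "(of_rat q, of_rat q) \<in> \<Gamma>"
proof -
  interpret field_graph \<Gamma> by fact
  show ?thesis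
    by (cases q) (simp add: of_rat_rat divide_inverse mult inverse of_int)
qed

lemma field_graph_rat_pols:
  fixes \<Gamma> :: "('a::field_char_0 \<times> 'b::field_char_0) set"
  assumes "field_graph \<Gamma>"
  shows "(map_poly of_rat p, map_poly of_rat p) \<in> field_graph.pols \<Gamma>"
  using field_graph_of_rat_mem[OF assms] by (simp add: field_graph.pols_def[OF assms] coeff_map_poly)

section \<open>The Galois hull\<close>

lemma type_algebra_simps:
  "one ring_of_type_algebra = 1" "zero ring_of_type_algebra = 0"
  "mult ring_of_type_algebra x y = x * y" "add ring_of_type_algebra x y = x + y"
  by (simp_all add: ring_of_type_algebra_def)

lemma type_algebra_a_inv: "a_inv ring_of_type_algebra x = - (x :: 'a::field)"
proof -
  interpret field "ring_of_type_algebra :: 'a ring"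
    by (rule field_from_type_algebra)
  show ?thesis
    by (rule minus_equality) (auto simp: ring_of_type_algebra_def)
qed

lemma type_algebra_m_inv: "x \<noteq> 0 \<Longrightarrow> m_inv ring_of_type_algebra x = inverse (x :: 'a::field)"
proof -
  interpret field "ring_of_type_algebra :: 'a ring"
    by (rule field_from_type_algebra)
  assume "x \<noteq> 0"
  then show ?thesis
    by (intro comm_inv_char) (auto simp: ring_of_type_algebra_def)
qed

lemma hull_induct [consumes 1, case_names incl one add mult uminus inverse]:
  assumes "x \<in> galois_hull TYPE('k::field_char_0)"
    and "\<And>\<sigma> a. field_emb (\<sigma> :: 'k::field_char_0 \<Rightarrow> complex) \<Longrightarrow> P (\<sigma> a)"
    and "P 1"
    and "\<And>x y. x \<in> galois_hull TYPE('k::field_char_0) \<Longrightarrow> y \<in> galois_hull TYPE('k::field_char_0) \<Longrightarrow> P x \<Longrightarrow> P y \<Longrightarrow> P (x + y)"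
    and "\<And>x y. x \<in> galois_hull TYPE('k::field_char_0) \<Longrightarrow> y \<in> galois_hull TYPE('k::field_char_0) \<Longrightarrow> P x \<Longrightarrow> P y \<Longrightarrow> P (x * y)"
    and "\<And>x. x \<in> galois_hull TYPE('k::field_char_0) \<Longrightarrow> P x \<Longrightarrow> P (- x)"
    and "\<And>x. x \<in> galois_hull TYPE('k::field_char_0) \<Longrightarrow> P x \<Longrightarrow> P (inverse x)"
  shows "P x"
  using assms(1) unfolding galois_hull_def
proof (induction rule: generate_field.induct)
  case (m_inv h)
  then show ?case
    using assms(7)[of h] by (simp add: type_algebra_simps type_algebra_m_inv galois_hull_def)
qed (use assms(2-6) in \<open>auto simp: type_algebra_simps type_algebra_a_inv embeddings_iff galois_hull_def\<close>)

lemma hull_incl: "field_emb (\<sigma> :: 'k::field_char_0 \<Rightarrow> complex) \<Longrightarrow> \<sigma> x \<in> galois_hull TYPE('k::field_char_0)"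
  unfolding galois_hull_def by (rule generate_field.incl) (auto simp flip: embeddings_iff)

lemma hull_one: "1 \<in> galois_hull TYPE('k::field_char_0)"
  using generate_field.one[of ring_of_type_algebra]
  by (auto simp: galois_hull_def type_algebra_simps)

lemma hull_add: "x \<in> galois_hull TYPE('k::field_char_0) \<Longrightarrow> y \<in> galois_hull TYPE('k::field_char_0) \<Longrightarrow> x + y \<in> galois_hull TYPE('k::field_char_0)"
  using generate_field.eng_add[of _ ring_of_type_algebra]
  by (auto simp: galois_hull_def type_algebra_simps)

lemma hull_mult: "x \<in> galois_hull TYPE('k::field_char_0) \<Longrightarrow> y \<in> galois_hull TYPE('k::field_char_0) \<Longrightarrow> x * y \<in> galois_hull TYPE('k::field_char_0)"
  using generate_field.eng_mult[of _ ring_of_type_algebra]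
  by (auto simp: galois_hull_def type_algebra_simps)

lemma hull_uminus: "x \<in> galois_hull TYPE('k::field_char_0) \<Longrightarrow> - x \<in> galois_hull TYPE('k::field_char_0)"
  using generate_field.a_inv[of x ring_of_type_algebra]
  by (auto simp: galois_hull_def type_algebra_a_inv)

lemma hull_inverse: "x \<in> galois_hull TYPE('k::field_char_0) \<Longrightarrow> inverse x \<in> galois_hull TYPE('k::field_char_0)"
  using generate_field.m_inv[of x ring_of_type_algebra]
  by (cases "x = 0") (auto simp: galois_hull_def type_algebra_simps type_algebra_m_inv)

lemma field_graph_hull: "field_graph (Id_on (galois_hull TYPE('k::field_char_0)))"
  by unfold_locales
    (auto simp: Id_on_iff intro: hull_one hull_add hull_mult hull_uminus hull_inverse)

lemma hull_of_rat: "of_rat q \<in> galois_hull TYPE('k::field_char_0)"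
  using field_graph_of_rat_mem[OF field_graph_hull] by auto

section \<open>Automorphisms of the Galois hull\<close>

lemma galois_group_carrierI:
  assumes "g \<in> extensional L" "bij_betw g L L"
    and "\<And>x y. x \<in> L \<Longrightarrow> y \<in> L \<Longrightarrow> g (x + y) = g x + g y"
    and "\<And>x y. x \<in> L \<Longrightarrow> y \<in> L \<Longrightarrow> g (x * y) = g x * g y"
    and "\<And>q. g (of_rat q) = of_rat q"
  shows "g \<in> carrier (galois_group L)"
  using assms bij_betwE[OF assms(2)] assms(5)[of 1]
  by (auto simp: galois_group_def Bij_def ring_hom_def ring_of_type_algebra_def elim: Rats_cases)

lemma galois_group_carrierD:
  assumes "g \<in> carrier (galois_group L)"
  shows "g \<in> extensional L" "bij_betw g L L" "x \<in> L \<Longrightarrow> g x \<in> L"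
    "x \<in> L \<Longrightarrow> y \<in> L \<Longrightarrow> g (x + y) = g x + g y"
    "x \<in> L \<Longrightarrow> y \<in> L \<Longrightarrow> g (x * y) = g x * g y"
    "g (of_rat q) = of_rat q" "g \<in> Bij L"
  using assms bij_betwE[of g L L]
  by (auto simp: galois_group_def Bij_def ring_hom_def ring_of_type_algebra_def)

lemma galois_group_mult:
  assumes "g \<in> carrier (galois_group L)" "h \<in> carrier (galois_group L)"
  shows "g \<otimes>\<^bsub>galois_group L\<^esub> h = compose L g h"
  using galois_group_carrierD(7)[OF assms(1)] galois_group_carrierD(7)[OF assms(2)]
  by (simp add: galois_group_def BijGroup_def)

lemma galois_group_closed:
  assumes g: "g \<in> carrier (galois_group L)" and h: "h \<in> carrier (galois_group L)"
    and L: "\<And>x y. x \<in> L \<Longrightarrow> y \<in> L \<Longrightarrow> x + y \<in> L \<and> x * y \<in> L" "\<And>q. of_rat q \<in> L"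
  shows "g \<otimes>\<^bsub>galois_group L\<^esub> h \<in> carrier (galois_group L)"
  unfolding galois_group_mult[OF g h]
proof (rule galois_group_carrierI)
  show "bij_betw (compose L g h) L L"
    using g h by (meson bij_betw_compose galois_group_carrierD(2))
qed (auto simp: compose_def L galois_group_carrierD[OF g] galois_group_carrierD[OF h])

lemma galois_group_emb:
  assumes g: "g \<in> carrier (galois_group (galois_hull TYPE('k::field_char_0)))"
    and "field_emb (\<sigma> :: 'k::field_char_0 \<Rightarrow> complex)"
  shows "field_emb (g \<circ> \<sigma>)"
proof -
  interpret field_emb \<sigma> by fact
  show ?thesis
    using galois_group_carrierD(4,5)[OF g] galois_group_carrierD(6)[OF g, of 1]
    by unfold_locales (auto simp: add mult one hull_incl assms(2))
qed

text \<open>The hull is generated by the conjugates of K, so a graph defined on these is defined on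
  all of it. It maps conjugates to conjugates, which keeps the hull inside itself; surjectivity is
  checked on generators.\<close>

lemma field_graph_automorphism:
  fixes M :: "(complex \<times> complex) set"
  assumes "field_graph M" and alg: "algebraic_over_Q TYPE('k::field_char_0)"
    and dom: "\<And>\<sigma> x. field_emb (\<sigma> :: 'k::field_char_0 \<Rightarrow> complex) \<Longrightarrow> \<sigma> x \<in> Domain M"
  obtains g where "g \<in> carrier (galois_group (galois_hull TYPE('k::field_char_0)))"
    "\<And>x. x \<in> galois_hull TYPE('k::field_char_0) \<Longrightarrow> (x, g x) \<in> M"
proof -
  interpret field_graph M by fact
  define L where "L = galois_hull TYPE('k::field_char_0)"
  define \<phi> where "\<phi> x = (THE y. (x, y) \<in> M)" for x
  have \<phi>I: "(x, y) \<in> M \<Longrightarrow> \<phi> x = y" for x y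
    unfolding \<phi>_def using unique by blast
  have dom_L: "(x, \<phi> x) \<in> M" if "x \<in> L" for x
  proof -
    have "x \<in> Domain M"
      using that unfolding L_def
      by (induction rule: hull_induct) (auto intro: one add mult uminus inverse dom)
    then show ?thesis
      using \<phi>I by blast
  qed
  have hom: "\<phi> (x + y) = \<phi> x + \<phi> y" "\<phi> (x * y) = \<phi> x * \<phi> y" if "x \<in> L" "y \<in> L" for x y
    using dom_L[OF that(1)] dom_L[OF that(2)] by (auto intro!: \<phi>I add mult)
  have hom': "\<phi> (- x) = - \<phi> x" "\<phi> (inverse x) = inverse (\<phi> x)" if "x \<in> L" for x
    using dom_L[OF that(1)] by (auto intro!: \<phi>I uminus inverse)
  have rat: "\<phi> (of_rat q) = of_rat q" for q
    by (intro \<phi>I field_graph_of_rat_mem assms)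
  have inj: "x = y" if "x \<in> L" "y \<in> L" "\<phi> x = \<phi> y" for x y
    using diff[OF dom_L[OF that(1)] dom_L[OF that(2)]] that(3) zero_snd by fastforce
  have emb: "field_emb (\<phi> \<circ> \<sigma>)" if "field_emb \<sigma>" for \<sigma> :: "'k \<Rightarrow> complex"
  proof -
    interpret s: field_emb \<sigma> by fact
    show ?thesis
      using hom rat[of 1] hull_incl[OF that]
      by unfold_locales (auto simp: L_def s.add s.mult s.one)
  qed
  have closed: "\<phi> x \<in> L" if "x \<in> L" for x
    using that unfolding L_def
  proof (induction rule: hull_induct)
    case (incl \<sigma> a)
    then show ?case
      using hull_incl[OF emb[OF incl], of a] by simp
  qed (use hom hom' rat[of 1] in \<open>auto simp: L_def intro: hull_one hull_add hull_mult hull_uminus hull_inverse\<close>)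
  have surj: "x \<in> \<phi> ` L" if "x \<in> L" for x
    using that unfolding L_def
  proof (induction rule: hull_induct)
    case (incl \<sigma> a)
    obtain p :: "rat poly" where p: "p \<noteq> 0" "poly (map_poly of_rat p) a = 0"
      using alg unfolding algebraic_over_Q_def by blast
    \<comment> \<open>The map permutes the finitely many roots in L of a rational polynomial that
      kills a, being injective on them; \<sigma> a is one of these roots and so has a
      preimage.\<close>
    define R where "R = {y \<in> L. poly (map_poly of_rat p) y = 0}"
    have "finite R"
      using p(1) unfolding R_def
      by (intro finite_subset[OF _ poly_roots_finite]) (auto simp: map_poly_eq_0_iff)
    moreover have "\<phi> ` R \<subseteq> R"
    proof
      fix z assume "z \<in> \<phi> ` R"
      then obtain y where y: "y \<in> L" "poly (map_poly of_rat p) y = 0" "z = \<phi> y"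
        by (auto simp: R_def)
      have "(poly (map_poly of_rat p) y, poly (map_poly of_rat p) (\<phi> y)) \<in> M"
        by (intro pols_poly field_graph_rat_pols assms dom_L y)
      then show "z \<in> R"
        using y zero_fst closed by (auto simp: R_def)
    qed
    moreover have "inj_on \<phi> R"
      using inj by (auto simp: R_def intro!: inj_onI)
    ultimately have "\<phi> ` R = R"
      by (simp add: endo_inj_surj)
    moreover have "\<sigma> a \<in> R"
      using field_emb.rat_poly_image[OF incl p(2)] hull_incl[OF incl] by (simp add: R_def L_def)
    ultimately show ?case
      by (auto simp: R_def L_def)
  next
    case one
    then show ?case
      using rat[of 1] hull_one by (metis image_eqI of_rat_1)
  next
    case (add x y)
    then obtain u v where "u \<in> L" "v \<in> L" "x = \<phi> u" "y = \<phi> v"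
      by (auto simp: L_def)
    then show ?case
      using hom(1) hull_add by (metis L_def image_eqI)
  next
    case (mult x y)
    then obtain u v where "u \<in> L" "v \<in> L" "x = \<phi> u" "y = \<phi> v"
      by (auto simp: L_def)
    then show ?case
      using hom(2) hull_mult by (metis L_def image_eqI)
  next
    case (uminus x)
    then obtain u where "u \<in> L" "x = \<phi> u"
      by (auto simp: L_def)
    then show ?case
      using hom'(1) hull_uminus by (metis L_def image_eqI)
  next
    case (inverse x)
    then obtain u where "u \<in> L" "x = \<phi> u"
      by (auto simp: L_def)
    then show ?case
      using hom'(2) hull_inverse by (metis L_def image_eqI)
  qed
  have "restrict \<phi> L \<in> carrier (galois_group L)"
  proof (rule galois_group_carrierI)
    show "bij_betw (restrict \<phi> L) L L"
      using inj closed surj unfolding bij_betw_def by (auto intro!: inj_onI)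
  qed (auto simp: hom L_def hull_add hull_mult hull_of_rat rat)
  then show ?thesis
    using that[of "restrict \<phi> L"] dom_L by (simp add: L_def)
qed

text \<open>Since y is a simple root, the cofactor of its linear factor takes the value m'(y), which
  is nonzero, at y; any root of the cofactor therefore differs from y.\<close>

lemma ex_other_root:
  fixes m :: "complex poly"
  assumes "m \<noteq> 0" "poly m y = 0" "degree m \<noteq> 1" "poly (pderiv m) y \<noteq> 0"
  shows "\<exists>\<beta>. \<beta> \<noteq> y \<and> poly m \<beta> = 0"
proof -
  obtain k where k: "m = [:- y, 1:] * k"
    using assms(2) by (auto simp: poly_eq_0_iff_dvd)
  have "poly k y \<noteq> 0"
    using assms(4) by (auto simp: k pderiv_mult pderiv_pCons simp del: mult_pCons_left)
  moreover have "degree m = degree [:- y, 1:] + degree k"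
    unfolding k by (rule degree_mult_eq) (use assms(1) k in auto)
  then have "degree k > 0"
    using assms(3) by simp
  then obtain \<beta> where "poly k \<beta> = 0"
    using alg_closed_imp_poly_has_root by blast
  ultimately show ?thesis
    by (auto simp: k)
qed

text \<open>The minimal polynomial of an element outside F has degree at least 2 and is separable,
  so it has a second root \<beta>. Sending the element to \<beta> over F extends to an automorphism
  of the hull.\<close>

proposition ex_automorphism_moving:
  fixes \<tau> :: "'k::field_char_0 \<Rightarrow> complex"
  assumes alg: "algebraic_over_Q TYPE('k)" and F: "field_graph (Id_on F)"
    and \<tau>: "field_emb \<tau>" and x: "\<tau> x \<notin> F"
  obtains g where "g \<in> carrier (galois_group (galois_hull TYPE('k)))"
    "\<And>y. y \<in> F \<Longrightarrow> y \<in> galois_hull TYPE('k) \<Longrightarrow> g y = y" "g (\<tau> x) \<noteq> \<tau> x"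
proof -
  interpret field_graph "Id_on F" by fact
  have pols_Id: "q = p" if "(p, q) \<in> pols" for p q
    using pols_coeff[OF that] by (auto simp: poly_eq_iff)
  define y where "y = \<tau> x"
  have rat_root: "\<exists>p::rat poly. p \<noteq> 0 \<and> poly (map_poly of_rat p) (\<sigma> a) = 0"
    if "field_emb \<sigma>" for \<sigma> :: "'k \<Rightarrow> complex" and a
    using alg field_emb.rat_poly_image[OF that] unfolding algebraic_over_Q_def by metis
  obtain p :: "rat poly" where "p \<noteq> 0" "poly (map_poly of_rat p) y = 0"
    using rat_root[OF \<tau>] by (auto simp: y_def)
  then obtain m m' where m: "(m, m') \<in> pols" "m \<noteq> 0" "poly m y = 0"
    and minimal: "\<And>p q. (p, q) \<in> pols \<Longrightarrow> poly p y = 0 \<Longrightarrow> p \<noteq> 0 \<Longrightarrow> degree m \<le> degree p"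
    using ex_minpoly[OF field_graph_rat_pols[OF F], of p y] by (auto simp: map_poly_eq_0_iff)
  have "m' = m"
    using pols_Id m by blast
  have deg0: "degree m \<noteq> 0"
    using m degree_pos_of_root by force
  have deg1: "degree m \<noteq> 1"
  proof
    assume "degree m = 1"
    then obtain a b where ab: "m = [:a, b:]" "b \<noteq> 0"
      by (metis degree1_coeffs)
    have "a \<in> F" "b \<in> F"
      using pols_coeff[OF m(1), of 0] pols_coeff[OF m(1), of 1] by (auto simp: ab)
    moreover have "y = - a * inverse b"
      using m(3) ab by (simp add: field_simps eq_neg_iff_add_eq_0)
    ultimately have "y \<in> F"
      using mult[OF uminus inverse, of a a b b] by auto
    then show False
      using x by (simp add: y_def)
  qed
  \<comment> \<open>Separability in characteristic 0: the derivative is nonzero and of smaller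
    degree, so by minimality it cannot vanish at y.\<close>
  have "(pderiv m, pderiv m) \<in> pols"
    using mult[OF of_nat pols_coeff[OF m(1)]] \<open>m' = m\<close>
    by (simp add: pols_def coeff_pderiv del: of_nat_Suc)
  moreover have "degree (pderiv m) < degree m" "pderiv m \<noteq> 0"
    using deg0 by (auto simp: degree_pderiv pderiv_eq_0_iff)
  ultimately have "poly (pderiv m) y \<noteq> 0"
    using minimal by (meson linorder_not_le)
  then obtain \<beta> where \<beta>: "\<beta> \<noteq> y" "poly m \<beta> = 0"
    using ex_other_root m(2,3) deg1 by blast
  interpret field_graph_minpoly "Id_on F" m m' y \<beta>
    using m minimal \<beta> \<open>m' = m\<close> by unfold_locales auto
  obtain M where M: "field_graph M" "adjoin \<subseteq> M"
    and closed: "\<And>p q y. (p, q) \<in> field_graph.pols M \<Longrightarrow> p \<noteq> 0 \<Longrightarrow> poly p y = 0 \<Longrightarrow> y \<in> Domain M"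
    using extend_field_graph[OF field_graph_adjoin] by blast
  interpret M: field_graph M by fact
  have "\<sigma> a \<in> Domain M" if "field_emb \<sigma>" for \<sigma> :: "'k \<Rightarrow> complex" and a
    using rat_root[OF that, of a] closed[OF field_graph_rat_pols[OF M(1)]]
    by (auto simp: map_poly_eq_0_iff)
  then obtain g where g: "g \<in> carrier (galois_group (galois_hull TYPE('k)))"
    "\<And>x. x \<in> galois_hull TYPE('k) \<Longrightarrow> (x, g x) \<in> M"
    using field_graph_automorphism[OF M(1) alg] by blast
  have "Id_on F \<subseteq> M"
    using subset_adjoin M(2) by blast
  then have "g y = y" if "y \<in> F" "y \<in> galois_hull TYPE('k)" for y
    using that g(2)[OF that(2)] M.unique by blast
  moreover have "g y = \<beta>"
    using g(2)[OF hull_incl[OF \<tau>, of x]] new_in_adjoin M M.unique unfolding y_def by blast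
  ultimately show ?thesis
    using that g(1) \<beta>(1) by (auto simp: y_def)
qed

section \<open>An involution of the quartic field\<close>

lemma central_preserves_range:
  fixes \<sigma> :: "'k::field_char_0 \<Rightarrow> complex"
  defines "G \<equiv> galois_group (galois_hull TYPE('k))"
  assumes alg: "algebraic_over_Q TYPE('k)" and z: "z \<in> carrier G"
    and central: "\<And>g. g \<in> carrier G \<Longrightarrow> g \<otimes>\<^bsub>G\<^esub> z = z \<otimes>\<^bsub>G\<^esub> g"
    and \<sigma>: "field_emb \<sigma>"
  shows "z (\<sigma> x) \<in> range \<sigma>"
proof (rule ccontr)
  assume "z (\<sigma> x) \<notin> range \<sigma>"
  then obtain g where g: "g \<in> carrier G"
    "\<And>y. y \<in> range \<sigma> \<Longrightarrow> y \<in> galois_hull TYPE('k) \<Longrightarrow> g y = y" "g (z (\<sigma> x)) \<noteq> z (\<sigma> x)"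
    using ex_automorphism_moving[OF alg field_emb.field_graph_range[OF \<sigma>]
        galois_group_emb[OF z[unfolded G_def] \<sigma>], of x] by (auto simp: G_def)
  have "(g \<otimes>\<^bsub>G\<^esub> z) (\<sigma> x) = (z \<otimes>\<^bsub>G\<^esub> g) (\<sigma> x)"
    using central g(1) by simp
  then show False
    using g z hull_incl[OF \<sigma>, of x] by (simp add: G_def galois_group_mult compose_eq)
qed

lemma ex_central_involution:
  assumes "galois_group L \<cong> square_group"
    and L: "\<And>x y. x \<in> L \<Longrightarrow> y \<in> L \<Longrightarrow> x + y \<in> L \<and> x * y \<in> L" "\<And>q. of_rat q \<in> L"
  obtains z where "z \<in> carrier (galois_group L)"
    "\<And>g. g \<in> carrier (galois_group L) \<Longrightarrow> g \<otimes>\<^bsub>galois_group L\<^esub> z = z \<otimes>\<^bsub>galois_group L\<^esub> g"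
    "\<And>x. x \<in> L \<Longrightarrow> z (z x) = x" "\<exists>x\<in>L. z x \<noteq> x"
proof -
  define G where "G = galois_group L"
  define \<iota> where "\<iota> = restrict (\<lambda>x. x) L"
  obtain h where h: "h \<in> iso G square_group"
    using assms(1) by (auto simp: is_iso_def G_def)
  then have bij: "bij_betw h (carrier G) (carrier square_group)"
    and hmult: "\<And>a b. a \<in> carrier G \<Longrightarrow> b \<in> carrier G \<Longrightarrow> h (a \<otimes>\<^bsub>G\<^esub> b) = h a \<circ> h b"
    by (auto simp: iso_def hom_def square_group_def)
  have closed: "a \<otimes>\<^bsub>G\<^esub> b \<in> carrier G" if "a \<in> carrier G" "b \<in> carrier G" for a b
    using that galois_group_closed L unfolding G_def by blast
  have inj: "a = b" if "a \<in> carrier G" "b \<in> carrier G" "h a = h b" for a b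
    using bij that by (auto simp: bij_betw_def inj_on_def)
  have linear: "f (- x) = - f x" if "f \<in> carrier square_group" for f x
    using that unfolding carrier_square_group by auto
  have \<iota>: "\<iota> \<in> carrier G"
    unfolding G_def \<iota>_def by (rule galois_group_carrierI) (auto simp: L bij_betw_def inj_on_def)
  \<comment> \<open>To see that h maps \<iota> to the identity: \<open>h \<iota>\<close> is
    idempotent, and an injective idempotent map is the identity.\<close>
  have "\<iota> \<otimes>\<^bsub>G\<^esub> \<iota> = \<iota>"
    using \<iota> by (auto simp: G_def galois_group_mult \<iota>_def compose_def)
  then have h\<iota>: "h \<iota> \<circ> h \<iota> = h \<iota>"
    using hmult[OF \<iota> \<iota>] by simp
  moreover have "h \<iota> \<in> carrier square_group"
    using bij \<iota> bij_betwE by blast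
  moreover have "inj f" if "f \<in> carrier square_group" for f
    using that by (auto simp: square_group_def intro!: injI) (metis dist_eq_0_iff)
  ultimately have h\<iota>: "h \<iota> = id"
    by (auto simp: fun_eq_iff inj_def)
  \<comment> \<open>The half turn about the centre of the square. It is central because every
    symmetry of the square is an odd map.\<close>
  have "(\<lambda>x. - x) \<in> carrier square_group"
    unfolding carrier_square_group square_vertices_def by auto
  then obtain z where z: "z \<in> carrier G" "h z = (\<lambda>x. - x)"
    using bij unfolding bij_betw_def by (metis imageE)
  have "g \<otimes>\<^bsub>G\<^esub> z = z \<otimes>\<^bsub>G\<^esub> g" if "g \<in> carrier G" for g
  proof (rule inj)
    have "h g \<in> carrier square_group"
      using bij that bij_betwE by blast
    then show "h (g \<otimes>\<^bsub>G\<^esub> z) = h (z \<otimes>\<^bsub>G\<^esub> g)"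
      using that z linear by (auto simp: hmult)
  qed (use that z closed in auto)
  moreover have "z \<otimes>\<^bsub>G\<^esub> z = \<iota>"
    by (rule inj) (use z closed \<iota> h\<iota> in \<open>auto simp: hmult\<close>)
  then have "z (z x) = x" if "x \<in> L" for x
    using z(1) that by (auto simp: G_def galois_group_mult \<iota>_def compose_def fun_eq_iff split: if_splits)
  moreover have "\<exists>x\<in>L. z x \<noteq> x"
  proof (rule ccontr)
    assume "\<not> (\<exists>x\<in>L. z x \<noteq> x)"
    then have "z = \<iota>"
      using galois_group_carrierD(1)[OF z(1)[unfolded G_def]]
      by (auto simp: \<iota>_def fun_eq_iff extensional_def restrict_def)
    then have "- 1 = (1 :: complex)"
      using z(2) h\<iota> by (metis id_apply)
    then show False
      by simp
  qed
  ultimately show ?thesis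
    using that z(1) by (simp add: G_def)
qed

proposition ex_field_involution:
  assumes alg: "algebraic_over_Q TYPE('k::field_char_0)"
    and iso: "galois_group (galois_hull TYPE('k::field_char_0)) \<cong> square_group"
  obtains \<sigma> :: "'k::field_char_0 \<Rightarrow> complex" and \<rho> :: "'k \<Rightarrow> 'k"
  where "field_emb \<sigma>" "field_emb \<rho>" "\<And>x. \<rho> (\<rho> x) = x" "\<exists>x. \<rho> x \<noteq> x"
proof -
  define L where "L = galois_hull TYPE('k)"
  obtain z where z: "z \<in> carrier (galois_group L)"
    and central: "\<And>g. g \<in> carrier (galois_group L) \<Longrightarrow>
      g \<otimes>\<^bsub>galois_group L\<^esub> z = z \<otimes>\<^bsub>galois_group L\<^esub> g"
    and zz: "\<And>x. x \<in> L \<Longrightarrow> z (z x) = x" and nontrivial: "\<exists>x\<in>L. z x \<noteq> x"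
    by (rule ex_central_involution[OF iso[folded L_def]])
      (simp_all add: L_def hull_add hull_mult hull_of_rat)
  note zD = galois_group_carrierD[OF z]
  have z_uminus: "z (- x) = - z x" if "x \<in> L" for x
    using zD(5)[of "-1" x] zD(6)[of "-1"] that hull_of_rat[of "-1"] by (simp add: L_def)
  have z_inverse: "z (inverse x) = inverse (z x)" if "x \<in> L" for x
  proof (cases "x = 0")
    case True
    then show ?thesis
      using zD(6)[of 0] by simp
  next
    case False
    then have "z x * z (inverse x) = 1"
      using zD(5)[of x "inverse x"] zD(6)[of 1] that hull_inverse[OF that[unfolded L_def]]
      by (simp add: L_def)
    then show ?thesis
      by (simp add: inverse_unique)
  qed
  \<comment> \<open>The conjugates of K generate the hull, so a nontrivial z must move an element of
    one of them. This embedding is the one through which z is pulled back to K.\<close>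
  have "\<exists>\<sigma> x. field_emb (\<sigma> :: 'k \<Rightarrow> complex) \<and> z (\<sigma> x) \<noteq> \<sigma> x"
  proof (rule ccontr)
    assume *: "\<nexists>\<sigma> x. field_emb (\<sigma> :: 'k \<Rightarrow> complex) \<and> z (\<sigma> x) \<noteq> \<sigma> x"
    have "z x = x" if "x \<in> L" for x
      using that unfolding L_def
    proof (induction rule: hull_induct)
      case one
      then show ?case
        using zD(6)[of 1] by simp
    qed (use * zD z_uminus z_inverse in \<open>auto simp: L_def\<close>)
    then show False
      using nontrivial by blast
  qed
  then obtain \<sigma> a where \<sigma>: "field_emb (\<sigma> :: 'k \<Rightarrow> complex)" and a: "z (\<sigma> a) \<noteq> \<sigma> a"
    by blast
  interpret \<sigma>: field_emb \<sigma> by fact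
  interpret z\<sigma>: field_emb "z \<circ> \<sigma>"
    using galois_group_emb[OF _ \<sigma>] z by (simp add: L_def)
  have "\<exists>y. \<sigma> y = z (\<sigma> x)" for x
    using central_preserves_range[OF alg _ _ \<sigma>, of z x] z central by (force simp: L_def)
  then obtain \<rho> where \<rho>: "\<sigma> (\<rho> x) = z (\<sigma> x)" for x
    by metis
  have "field_emb \<rho>"
  proof
    show "\<rho> (x + y) = \<rho> x + \<rho> y" "\<rho> (x * y) = \<rho> x * \<rho> y" "\<rho> 1 = 1" for x y
      using z\<sigma>.add z\<sigma>.mult z\<sigma>.one
      by (simp_all add: \<rho> \<sigma>.add \<sigma>.mult \<sigma>.one flip: \<sigma>.eq_iff)
  qed
  moreover have "\<rho> (\<rho> x) = x" for x
    using zz hull_incl[OF \<sigma>, of x] by (simp add: \<rho> L_def flip: \<sigma>.eq_iff)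
  moreover have "\<rho> a \<noteq> a"
    using a \<rho> by metis
  ultimately show ?thesis
    using that \<sigma> by blast
qed

section \<open>The tower of quadratic extensions\<close>

interpretation Q: vector_space "\<lambda>(q::rat) (x::'a::field_char_0). of_rat q * x"
  by unfold_locales (simp_all add: algebra_simps of_rat_add of_rat_mult)

lemma algebraic_over_Q_if_degree_pos:
  assumes "degree_over_Q TYPE('k::field_char_0) > 0"
  shows "algebraic_over_Q TYPE('k)"
  unfolding algebraic_over_Q_def
proof
  fix x :: 'k
  obtain B :: "'k set" where B: "UNIV \<subseteq> Q.span B" "card B = degree_over_Q TYPE('k)"
    unfolding degree_over_Q_def using Q.basis_exists[of UNIV] by metis
  \<comment> \<open>\<open>card\<close> is 0 on infinite sets, so a positive degree makes the basis
    finite.\<close>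
  have "finite B"
    using assms B(2) by (metis card.infinite less_numeral_extra(3))
  define n where "n = card B"
  show "\<exists>p::rat poly. p \<noteq> 0 \<and> poly (map_poly of_rat p) x = 0"
  \<comment> \<open>Linear dependence is a property of the set of powers, so coinciding powers are
    treated apart; they make x a root of a difference of two monomials.\<close>
  proof (cases "inj_on (\<lambda>i. x ^ i) {..n}")
    case True
    then have "card ((\<lambda>i. x ^ i) ` {..n}) = Suc n"
      by (simp add: card_image)
    then have "Q.dependent ((\<lambda>i. x ^ i) ` {..n})"
      using Q.independent_span_bound[OF \<open>finite B\<close>, of "(\<lambda>i. x ^ i) ` {..n}"] B(1)
      by (fastforce simp: n_def)
    then obtain u i where u: "i \<le> n" "u (x ^ i) \<noteq> 0"
      "(\<Sum>v\<in>(\<lambda>i. x ^ i) ` {..n}. of_rat (u v) * v) = 0"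
      by (subst (asm) Q.dependent_finite) auto
    define p where "p = (\<Sum>i\<le>n. monom (u (x ^ i)) i)"
    have coeff: "coeff p i = (if i \<le> n then u (x ^ i) else 0)" for i
      by (simp add: p_def coeff_sum)
    then have "p \<noteq> 0"
      using u by (metis coeff_0)
    have "degree p \<le> n"
      by (rule degree_le) (simp add: coeff)
    then have "poly (map_poly of_rat p) x = (\<Sum>i\<le>n. of_rat (coeff p i) * x ^ i)"
      by (simp add: poly_altdef degree_map_poly coeff_map_poly)
        (rule sum.mono_neutral_left, auto simp: coeff_eq_0)
    also have "\<dots> = 0"
      using u(3) by (simp add: sum.reindex[OF True] coeff)
    finally show ?thesis
      using \<open>p \<noteq> 0\<close> by blast
  next
    case False
    then obtain i j where ij: "i \<noteq> j" "x ^ i = x ^ j"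
      by (auto simp: inj_on_def)
    have "map_poly of_rat (monom (1::rat) i - monom 1 j) = (monom 1 i - monom 1 j :: 'k poly)"
      by (rule poly_eqI) (simp add: coeff_map_poly of_rat_diff)
    then show ?thesis
      using ij by (intro exI[of _ "monom 1 i - monom 1 j"]) (auto simp: poly_monom monom_eq_iff')
  qed
qed

text \<open>K is the direct sum of the even and odd parts under \<rho>. Multiplication by the odd
  element r maps F bijectively onto the odd part, so 4 is twice the dimension of F.\<close>

lemma quartic_fixed_field_dim:
  fixes \<rho> :: "'k::field_char_0 \<Rightarrow> 'k"
  assumes deg: "degree_over_Q TYPE('k) = 4"
    and \<rho>: "field_emb \<rho>" "\<And>x. \<rho> (\<rho> x) = x" and r: "r \<noteq> 0" "\<rho> r = - r"
  shows "Q.dim {x. \<rho> x = x} = 2"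
    and "\<And>x. \<exists>f g. \<rho> f = f \<and> \<rho> g = g \<and> x = f + r * g"
proof -
  interpret \<rho>: field_emb \<rho> by fact
  obtain B :: "'k set" where B: "Q.independent B" "UNIV \<subseteq> Q.span B" "card B = 4"
    using Q.basis_exists[of UNIV] deg unfolding degree_over_Q_def by metis
  have "finite B"
    using B(3) by (metis card.infinite zero_neq_numeral)
  interpret fin: finite_dimensional_vector_space "\<lambda>(q::rat) (x::'k). of_rat q * x" B
    using B \<open>finite B\<close> by unfold_locales auto
  interpret pair: finite_dimensional_vector_space_pair
    "\<lambda>(q::rat) (x::'k). of_rat q * x" B "\<lambda>(q::rat) (x::'k). of_rat q * x" B
    by unfold_locales
  define F where "F = {x. \<rho> x = x}"
  have F: "Q.subspace F"
    by (rule Q.subspaceI) (auto simp: F_def \<rho>.zero \<rho>.add \<rho>.mult \<rho>.of_rat)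
  have lin: "Vector_Spaces.linear (\<lambda>(q::rat) (x::'k). of_rat q * x) (\<lambda>(q::rat) (x::'k). of_rat q * x) ((*) r)"
    by unfold_locales (simp_all add: algebra_simps)
  have rF: "Q.subspace ((*) r ` F)"
    using pair.linear_subspace_image[OF lin F] .
  have dim_rF: "Q.dim ((*) r ` F) = Q.dim F"
    by (rule pair.dim_image_eq[OF lin]) (use r(1) in \<open>auto intro: inj_onI\<close>)
  show decomp: "\<exists>f g. \<rho> f = f \<and> \<rho> g = g \<and> x = f + r * g" for x
  proof (intro exI conjI)
    have two: "\<rho> 2 = 2"
      using \<rho>.of_nat[of 2] by simp
    show "\<rho> ((x + \<rho> x) * inverse 2) = (x + \<rho> x) * inverse 2"
      unfolding \<rho>.add \<rho>.mult \<rho>.inverse two \<rho>(2) by (simp only: add.commute)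
    show "\<rho> ((x - \<rho> x) * inverse (2 * r)) = (x - \<rho> x) * inverse (2 * r)"
      unfolding \<rho>.diff \<rho>.mult \<rho>.inverse two \<rho>(2) r(2) using r(1) by (simp add: field_simps)
    show "x = (x + \<rho> x) * inverse 2 + r * ((x - \<rho> x) * inverse (2 * r))"
      using r(1) by (simp add: field_simps)
  qed
  then have sum: "{x + y |x y. x \<in> F \<and> y \<in> (*) r ` F} = UNIV"
    by (auto simp: F_def) (metis (mono_tags, lifting) image_eqI mem_Collect_eq)
  have "F \<inter> (*) r ` F \<subseteq> {0}"
    using r by (auto simp: F_def \<rho>.mult eq_neg_iff_add_eq_0 simp flip: mult_2)
  then have "Q.dim (F \<inter> (*) r ` F) = 0"
    by simp
  then have "Q.dim (UNIV :: 'k set) = Q.dim F + Q.dim F"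
    using fin.dim_sums_Int[OF F rF] unfolding sum dim_rF by linarith
  then show "Q.dim {x. \<rho> x = x} = 2"
    using deg unfolding degree_over_Q_def F_def by simp
qed

lemma quadratic_field_generator:
  fixes F :: "'k::field_char_0 set"
  assumes dim: "Q.dim F = 2" and sub: "Q.subspace F" and one: "1 \<in> F"
    and mult: "\<And>x y. x \<in> F \<Longrightarrow> y \<in> F \<Longrightarrow> x * y \<in> F"
  obtains s d where "s \<in> F" "s\<^sup>2 = of_rat d" "s \<notin> range of_rat"
    "\<And>x. x \<in> F \<Longrightarrow> \<exists>p q. x = of_rat p + of_rat q * s"
proof -
  have "Q.independent {1 :: 'k}"
    by (simp add: Q.independent_insert)
  then obtain C where C: "{1} \<subseteq> C" "C \<subseteq> F" "Q.independent C" "F \<subseteq> Q.span C"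
    using Q.maximal_independent_subset_extend[of "{1}" F] one by blast
  have "card C = 2"
    using Q.basis_card_eq_dim[OF C(2,4,3)] dim by simp
  then obtain w where w: "C = {1, w}" "w \<noteq> 1"
    using C(1) by (metis card_2_iff doubleton_eq_iff insert_subset insertE singletonD)
  have span: "\<exists>p q. x = of_rat p + of_rat q * w" if "x \<in> F" for x
  proof -
    have "x \<in> Q.span {w, 1}"
      using C(4) that w(1) by (auto simp: insert_commute)
    then obtain q where "x - of_rat q * w \<in> Q.span {1}"
      unfolding Q.span_breakdown_eq[of x w "{1}"] by blast
    then obtain p where "x - of_rat q * w = of_rat p * 1"
      unfolding Q.span_singleton by blast
    then show ?thesis
      by (intro exI[of _ p] exI[of _ q]) (simp add: algebra_simps)
  qed
  have w_irr: "w \<noteq> of_rat q" for q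
  proof
    assume "w = of_rat q"
    then have "w \<in> Q.span {1}"
      by (auto simp: Q.span_singleton)
    moreover have "Q.independent (insert w {1})"
      using C(3) w(1) by (simp add: insert_commute)
    ultimately show False
      using w(2) by (simp add: Q.independent_insert)
  qed
  have "w \<in> F"
    using C(2) w(1) by simp
  then obtain p q where pq: "w * w = of_rat p + of_rat q * w"
    using span mult by blast
  \<comment> \<open>Half the linear coefficient in the equation of w: completing the square makes w
    - h a square root of a rational.\<close>
  define h where "h = q / 2"
  then have "q = h + h"
    by simp
  then have q: "of_rat q = (of_rat h + of_rat h :: 'k)"
    by (simp only: of_rat_add)
  define s where "s = w - of_rat h"
  show ?thesis
  proof
    have "of_rat h * 1 \<in> F"
      using sub one unfolding Q.subspace_def by blast
    then show "s \<in> F"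
      using Q.subspace_diff[OF sub \<open>w \<in> F\<close>] by (simp add: s_def)
    have "s\<^sup>2 = w * w - of_rat q * w + of_rat h * of_rat h"
      by (simp add: s_def q power2_eq_square of_rat_add algebra_simps)
    also have "\<dots> = of_rat (p + h * h)"
      by (simp add: pq of_rat_add of_rat_mult)
    finally show "s\<^sup>2 = of_rat (p + h * h)" .
    show "s \<notin> range of_rat"
    proof
      assume "s \<in> range of_rat"
      then obtain t where "s = of_rat t"
        by blast
      then have "w = of_rat (t + h)"
        by (simp add: s_def of_rat_add algebra_simps)
      then show False
        using w_irr by blast
    qed
    fix x assume "x \<in> F"
    then obtain a b where "x = of_rat a + of_rat b * w"
      using span by blast
    then have "x = of_rat (a + b * h) + of_rat b * s"
      by (simp add: s_def of_rat_add of_rat_mult algebra_simps)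
    then show "\<exists>p q. x = of_rat p + of_rat q * s"
      by blast
  qed
qed

text \<open>The field is spanned by 1, s, r, r s over the rationals. The coordinates are functions
  chosen value by value; they must vanish at 0 because they are applied to coefficients by
  \<open>Poly_Mapping.map\<close>, which keeps zero coefficients zero.\<close>

locale quadratic_tower =
  fixes \<rho> :: "'k::field_char_0 \<Rightarrow> 'k" and s r :: 'k and d b1 b2 :: rat and c1 c2 c3 c4 :: "'k \<Rightarrow> rat"
  assumes \<rho>: "field_emb \<rho>"
    and \<rho>s: "\<rho> s = s" and \<rho>r: "\<rho> r = - r" and r0: "r \<noteq> 0"
    and s2: "s\<^sup>2 = of_rat d" and s_irrational: "s \<notin> range of_rat"
    and r2: "r\<^sup>2 = of_rat b1 + of_rat b2 * s"
    and coords: "x = of_rat (c1 x) + of_rat (c2 x) * s + r * (of_rat (c3 x) + of_rat (c4 x) * s)"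
    and coords0: "c1 0 = 0" "c2 0 = 0" "c3 0 = 0" "c4 0 = 0"

proposition ex_quadratic_tower:
  fixes \<rho> :: "'k::field_char_0 \<Rightarrow> 'k"
  assumes deg: "degree_over_Q TYPE('k) = 4"
    and \<rho>: "field_emb \<rho>" "\<And>x. \<rho> (\<rho> x) = x" and nontrivial: "\<exists>x. \<rho> x \<noteq> x"
  obtains s r d b1 b2 c1 c2 c3 c4 where "quadratic_tower \<rho> s r d b1 b2 c1 c2 c3 c4"
proof -
  interpret \<rho>: field_emb \<rho> by fact
  obtain a where "\<rho> a \<noteq> a"
    using nontrivial by blast
  \<comment> \<open>An odd element for \<rho>; its square is fixed by \<rho> and so lies in F, which
    exhibits K as F(r).\<close>
  define r where "r = a - \<rho> a"
  have r: "r \<noteq> 0" "\<rho> r = - r"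
    using \<open>\<rho> a \<noteq> a\<close> by (simp_all add: r_def \<rho>.diff \<rho>(2))
  define F where "F = {x. \<rho> x = x}"
  have dim: "Q.dim F = 2" and decomp: "\<exists>f g. f \<in> F \<and> g \<in> F \<and> x = f + r * g" for x
    using quartic_fixed_field_dim[OF deg \<rho> r] by (auto simp: F_def)
  have "Q.subspace F"
    by (rule Q.subspaceI) (auto simp: F_def \<rho>.zero \<rho>.add \<rho>.mult \<rho>.of_rat)
  moreover have "1 \<in> F" "\<And>x y. x \<in> F \<Longrightarrow> y \<in> F \<Longrightarrow> x * y \<in> F"
    by (auto simp: F_def \<rho>.one \<rho>.mult)
  ultimately obtain s d where s: "s \<in> F" "s\<^sup>2 = of_rat d" "s \<notin> range of_rat"
    and span: "\<And>x. x \<in> F \<Longrightarrow> \<exists>p q. x = of_rat p + of_rat q * s"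
    using quadratic_field_generator[OF dim] by blast
  have "r\<^sup>2 \<in> F"
    using r(2) by (simp add: F_def \<rho>.power)
  then obtain b1 b2 where b: "r\<^sup>2 = of_rat b1 + of_rat b2 * s"
    using span by blast
  define good where "good x c \<longleftrightarrow> (case c of (p, q, p', q') \<Rightarrow>
    x = of_rat p + of_rat q * s + r * (of_rat p' + of_rat q' * s))" for x and c :: "rat \<times> rat \<times> rat \<times> rat"
  have "\<exists>c. good x c \<and> (x = 0 \<longrightarrow> c = (0, 0, 0, 0))" for x
  proof (cases "x = 0")
    case False
    obtain f g where "f \<in> F" "g \<in> F" "x = f + r * g"
      using decomp by blast
    moreover from this obtain p q p' q' where
      "f = of_rat p + of_rat q * s" "g = of_rat p' + of_rat q' * s"
      using span by meson
    ultimately show ?thesis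
      using False by (intro exI[of _ "(p, q, p', q')"]) (simp add: good_def)
  qed (auto simp: good_def)
  then obtain c where c: "\<And>x. good x (c x)" "c 0 = (0, 0, 0, 0)"
    by metis
  have "\<rho> s = s"
    using s(1) by (simp add: F_def)
  have "quadratic_tower \<rho> s r d b1 b2 (\<lambda>x. fst (c x)) (\<lambda>x. fst (snd (c x)))
    (\<lambda>x. fst (snd (snd (c x)))) (\<lambda>x. snd (snd (snd (c x))))"
    by unfold_locales (fact \<rho>(1) r s b \<open>\<rho> s = s\<close> c(1)[unfolded good_def case_prod_unfold] | simp add: c(2))+
  then show ?thesis
    by (rule that)
qed

section \<open>The complex embeddings of the tower\<close>

lemma of_real_of_rat: "of_real (of_rat q) = (of_rat q :: complex)"
proof -
  interpret field_emb "of_real :: real \<Rightarrow> complex"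
    by unfold_locales simp_all
  show ?thesis
    by (rule of_rat)
qed

lemma square_root_real:
  fixes z :: complex
  assumes "z\<^sup>2 = of_real x" "x \<ge> 0"
  shows "z \<in> \<real>"
proof -
  have "z\<^sup>2 = (of_real (sqrt x))\<^sup>2"
    using assms by (simp flip: of_real_power)
  then show ?thesis
    by (auto simp: power2_eq_iff)
qed

context quadratic_tower
begin

lemma emb_eqI:
  assumes "field_emb \<sigma>" "field_emb \<tau>" "\<sigma> s = \<tau> s" "\<sigma> r = \<tau> r"
  shows "\<sigma> = \<tau>"
proof
  interpret \<sigma>: field_emb \<sigma> by fact
  interpret \<tau>: field_emb \<tau> by fact
  fix x
  have "\<sigma> x = of_rat (c1 x) + of_rat (c2 x) * \<sigma> s + \<sigma> r * (of_rat (c3 x) + of_rat (c4 x) * \<sigma> s)"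
    by (subst coords[of x]) (simp add: \<sigma>.add \<sigma>.mult \<sigma>.of_rat)
  also have "\<dots> = \<tau> x"
    \<comment> \<open>The fifth occurrence of x is the argument of \<tau>; the first four are
      arguments of the coordinates.\<close>
    by (subst (5) coords[of x]) (simp add: \<tau>.add \<tau>.mult \<tau>.of_rat assms(3,4))
  finally show "\<sigma> x = \<tau> x" .
qed

lemma emb_s_square: "field_emb \<sigma> \<Longrightarrow> (\<sigma> s)\<^sup>2 = of_rat d"
  by (simp add: s2 field_emb.of_rat flip: field_emb.power)

lemma emb_r_square: "field_emb \<sigma> \<Longrightarrow> (\<sigma> r)\<^sup>2 = of_rat b1 + of_rat b2 * \<sigma> s"
  using arg_cong[OF r2, of \<sigma>]
  by (simp add: field_emb.power field_emb.add field_emb.mult field_emb.of_rat)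

lemma emb_comp_\<rho>: "field_emb \<sigma> \<Longrightarrow> field_emb (\<sigma> \<circ> \<rho>)"
  using \<rho> by (simp add: field_emb_def)

text \<open>The value at s fixes the square of the value at r; the remaining choice of sign is
  composition with \<rho>.\<close>

lemma emb_cases:
  assumes \<sigma>: "field_emb \<sigma>" and \<upsilon>: "field_emb \<upsilon>" and "\<upsilon> s = \<sigma> s"
  shows "\<upsilon> = \<sigma> \<or> \<upsilon> = \<sigma> \<circ> \<rho>"
proof -
  have "(\<upsilon> r)\<^sup>2 = (\<sigma> r)\<^sup>2"
    using assms by (simp add: emb_r_square)
  then have "\<upsilon> r = \<sigma> r \<or> \<upsilon> r = (\<sigma> \<circ> \<rho>) r"
    by (simp add: power2_eq_iff \<rho>r field_emb.uminus[OF \<sigma>])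
  then show ?thesis
    using emb_eqI[OF \<upsilon> \<sigma>] emb_eqI[OF \<upsilon> emb_comp_\<rho>[OF \<sigma>]] assms(3) \<rho>s by auto
qed

text \<open>An automorphism moving the irrational \<sigma> s still preserves its rational square, so
  it must change the sign.\<close>

lemma ex_conjugate_embedding:
  fixes \<sigma> :: "'k \<Rightarrow> complex"
  assumes alg: "algebraic_over_Q TYPE('k)" and \<sigma>: "field_emb \<sigma>"
  obtains \<tau> :: "'k \<Rightarrow> complex" where "field_emb \<tau>" "\<tau> s = - \<sigma> s"
proof -
  interpret \<sigma>: field_emb \<sigma> by fact
  have Q: "field_graph (Id_on (range (of_rat :: rat \<Rightarrow> complex)))"
    using field_emb_of_rat by (rule field_emb.field_graph_range)
  have "\<sigma> s \<notin> range of_rat"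
  proof
    assume "\<sigma> s \<in> range of_rat"
    then obtain q where "\<sigma> s = \<sigma> (of_rat q)"
      unfolding \<sigma>.of_rat by blast
    then have "s = of_rat q"
      by (simp only: \<sigma>.eq_iff)
    then show False
      using s_irrational by blast
  qed
  then obtain g where g: "g \<in> carrier (galois_group (galois_hull TYPE('k)))" "g (\<sigma> s) \<noteq> \<sigma> s"
    by (rule ex_automorphism_moving[OF alg Q \<sigma>])
  then have emb: "field_emb (g \<circ> \<sigma>)"
    using galois_group_emb \<sigma> by blast
  then have "(g (\<sigma> s))\<^sup>2 = (\<sigma> s)\<^sup>2"
    using emb_s_square[OF emb] emb_s_square[OF \<sigma>] by simp
  then have "g (\<sigma> s) = - \<sigma> s"
    using g(2) by (simp add: power2_eq_iff)
  then show ?thesis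
    using that[OF emb] by simp
qed

text \<open>The four sign choices at s and r. Distinctness matters because the norm form is a
  product over a set, where coinciding embeddings would lose factors.\<close>

lemma embeddings_eq:
  fixes \<sigma> \<tau> :: "'k \<Rightarrow> complex"
  assumes \<sigma>: "field_emb \<sigma>" and \<tau>: "field_emb \<tau>" "\<tau> s = - \<sigma> s"
  shows "embeddings = {\<sigma>, \<sigma> \<circ> \<rho>, \<tau>, \<tau> \<circ> \<rho>}"
    and "distinct [\<sigma>, \<sigma> \<circ> \<rho>, \<tau>, \<tau> \<circ> \<rho>]"
proof -
  show "embeddings = {\<sigma>, \<sigma> \<circ> \<rho>, \<tau>, \<tau> \<circ> \<rho>}"
  proof (intro equalityI subsetI)
    fix \<upsilon> :: "'k \<Rightarrow> complex" assume "\<upsilon> \<in> embeddings"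
    then have \<upsilon>: "field_emb \<upsilon>"
      by (simp add: embeddings_iff)
    then have "(\<upsilon> s)\<^sup>2 = (\<sigma> s)\<^sup>2"
      using emb_s_square \<sigma> by metis
    then have "\<upsilon> s = \<sigma> s \<or> \<upsilon> s = \<tau> s"
      using \<tau>(2) by (simp add: power2_eq_iff)
    then show "\<upsilon> \<in> {\<sigma>, \<sigma> \<circ> \<rho>, \<tau>, \<tau> \<circ> \<rho>}"
      using emb_cases \<sigma> \<tau>(1) \<upsilon> by blast
  qed (use \<sigma> \<tau> emb_comp_\<rho> in \<open>auto simp: embeddings_iff\<close>)
  have "s \<noteq> 0"
    using s_irrational by (metis of_rat_0 rangeI)
  then have "\<sigma> s \<noteq> \<tau> s"
    unfolding \<tau>(2) using field_emb.eq_zero_iff[OF \<sigma>] by (simp add: eq_neg_iff_add_eq_0 flip: mult_2)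
  then have s_ne: "\<upsilon> \<noteq> \<upsilon>'" if "\<upsilon> s = \<sigma> s" "\<upsilon>' s = \<tau> s" for \<upsilon> \<upsilon>' :: "'k \<Rightarrow> complex"
    using that by auto
  have r_ne: "\<upsilon> \<noteq> \<upsilon> \<circ> \<rho>" if "field_emb \<upsilon>" for \<upsilon> :: "'k \<Rightarrow> complex"
  proof
    assume "\<upsilon> = \<upsilon> \<circ> \<rho>"
    then have "\<upsilon> r = \<upsilon> (- r)"
      using \<rho>r by (metis comp_apply)
    then show False
      using r0 field_emb.eq_iff[OF that] by (simp add: eq_neg_iff_add_eq_0 flip: mult_2)
  qed
  show "distinct [\<sigma>, \<sigma> \<circ> \<rho>, \<tau>, \<tau> \<circ> \<rho>]"
    using r_ne[OF \<sigma>] r_ne[OF \<tau>(1)] by (simp add: s_ne \<rho>s)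
qed

text \<open>A nonnegative value would make \<sigma> r real, and with \<sigma> s real the whole image
  of K would be real.\<close>

lemma real_emb_r_square:
  assumes ti: "totally_imaginary TYPE('k)" and \<sigma>: "field_emb (\<sigma> :: 'k \<Rightarrow> complex)"
    and t: "\<sigma> s = of_real t"
  shows "of_rat b1 + of_rat b2 * t < (0 :: real)"
proof (rule ccontr)
  assume "\<not> of_rat b1 + of_rat b2 * t < 0"
  moreover have "(\<sigma> r)\<^sup>2 = of_real (of_rat b1 + of_rat b2 * t)"
    using emb_r_square[OF \<sigma>] by (simp add: t of_real_of_rat)
  ultimately have r: "\<sigma> r \<in> \<real>"
    using square_root_real by (metis linorder_not_le)
  have eq: "\<sigma> x = of_rat (c1 x) + of_rat (c2 x) * \<sigma> s + \<sigma> r * (of_rat (c3 x) + of_rat (c4 x) * \<sigma> s)" for x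
    by (subst coords[of x]) (simp add: field_emb.add[OF \<sigma>] field_emb.mult[OF \<sigma>] field_emb.of_rat[OF \<sigma>])
  have rat: "(of_rat q :: complex) \<in> \<real>" for q
    by (simp flip: of_real_of_rat)
  have "\<sigma> x \<in> \<real>" for x
    unfolding eq[of x] t by (intro Reals_add Reals_mult rat r Reals_of_real)
  then have "range \<sigma> \<subseteq> \<real>"
    by blast
  then show False
    using ti \<sigma> by (simp add: totally_imaginary_def embeddings_iff)
qed

text \<open>For d > 0 the two values of s are real numbers t and - t, so b1 + b2 t and b1 - b2 t are
  both negative. Their sum gives the first claim and their product the second.\<close>

lemma totally_negative:
  fixes \<sigma> \<tau> :: "'k \<Rightarrow> complex"
  assumes ti: "totally_imaginary TYPE('k)" and \<sigma>: "field_emb \<sigma>"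
    and \<tau>: "field_emb \<tau>" "\<tau> s = - \<sigma> s" and d: "d > 0"
  shows "b1 < 0" "b1\<^sup>2 - d * b2\<^sup>2 > 0"
proof -
  have "(\<sigma> s)\<^sup>2 = of_real (of_rat d)"
    using emb_s_square[OF \<sigma>] by (simp add: of_real_of_rat)
  then have "\<sigma> s \<in> \<real>"
    using d by (intro square_root_real) auto
  then obtain t where t: "\<sigma> s = of_real t"
    by (rule Reals_cases)
  then have "of_real (t\<^sup>2) = (of_real (of_rat d) :: complex)"
    using emb_s_square[OF \<sigma>] by (simp add: of_real_of_rat)
  then have t2: "t\<^sup>2 = of_rat d"
    by (simp only: of_real_eq_iff)
  have neg: "of_rat b1 + of_rat b2 * t < 0" "of_rat b1 + of_rat b2 * - t < 0"
    using real_emb_r_square[OF ti \<sigma> t] real_emb_r_square[OF ti \<tau>(1), of "- t"] t \<tau>(2) by auto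
  then have "of_rat b1 < (0 :: real)"
    by linarith
  then show "b1 < 0"
    by simp
  have "(0 :: real) < (of_rat b1 + of_rat b2 * t) * (of_rat b1 + of_rat b2 * - t)"
    using neg by (rule mult_neg_neg)
  also have "\<dots> = (of_rat b1)\<^sup>2 - t\<^sup>2 * (of_rat b2)\<^sup>2"
    by (simp add: power2_eq_square algebra_simps)
  also have "\<dots> = of_rat (b1\<^sup>2 - d * b2\<^sup>2)"
    by (simp add: t2 of_rat_diff of_rat_mult of_rat_power)
  finally show "b1\<^sup>2 - d * b2\<^sup>2 > 0"
    by simp
qed

end

section \<open>The norm form\<close>

lemma lookup_map:
  assumes "f 0 = 0"
  shows "Poly_Mapping.lookup (Poly_Mapping.map f p) k = f (Poly_Mapping.lookup p k)"
  using assms by (simp add: Poly_Mapping.map.rep_eq when_def)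

lemma lookup_const_mult:
  fixes p :: "'a::comm_ring_1 poly3"
  shows "Poly_Mapping.lookup (Poly_Mapping.single 0 c * p) k = c * Poly_Mapping.lookup p k"
  by (simp add: lookup_map flip: mult_map_scale_conv_mult)

lemma sum_single_lookup:
  "(\<Sum>k\<in>Poly_Mapping.keys p. Poly_Mapping.single k (Poly_Mapping.lookup p k)) = p"
  by (rule poly_mapping_eqI) (auto simp: lookup_sum lookup_single when_def in_keys_iff)

context field_emb
begin

lemma map_zero: "Poly_Mapping.map \<sigma> 0 = 0"
  by (rule poly_mapping_eqI) (simp add: lookup_map zero)

lemma map_add: "Poly_Mapping.map \<sigma> (p + q) = Poly_Mapping.map \<sigma> p + Poly_Mapping.map \<sigma> q"
  by (rule poly_mapping_eqI) (simp add: lookup_map zero add lookup_add)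

lemma map_diff: "Poly_Mapping.map \<sigma> (p - q) = Poly_Mapping.map \<sigma> p - Poly_Mapping.map \<sigma> q"
  by (rule poly_mapping_eqI) (simp add: lookup_map zero diff lookup_minus)

lemma map_single: "Poly_Mapping.map \<sigma> (Poly_Mapping.single k c) = Poly_Mapping.single k (\<sigma> c)"
  by (rule poly_mapping_eqI) (simp add: lookup_map zero lookup_single when_def)

lemma map_sum: "Poly_Mapping.map \<sigma> (sum f A) = (\<Sum>a\<in>A. Poly_Mapping.map \<sigma> (f a))"
  by (induction A rule: infinite_finite_induct) (simp_all add: map_zero map_add)

lemma map_mult:
  fixes p q :: "'a poly3"
  shows "Poly_Mapping.map \<sigma> (p * q) = Poly_Mapping.map \<sigma> p * Poly_Mapping.map \<sigma> q"
proof -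
  \<comment> \<open>Both sides are biadditive, so it suffices to compare products of single
    terms.\<close>
  have "Poly_Mapping.map \<sigma> (sum f A * sum g B)
      = Poly_Mapping.map \<sigma> (sum f A) * Poly_Mapping.map \<sigma> (sum g B)"
    if "\<And>a b. Poly_Mapping.map \<sigma> (f a * g b) = Poly_Mapping.map \<sigma> (f a) * Poly_Mapping.map \<sigma> (g b)"
    for f g :: "(3 \<Rightarrow>\<^sub>0 nat) \<Rightarrow> 'a poly3" and A B
    by (simp add: sum_product map_sum that)
  from this[of "\<lambda>k. Poly_Mapping.single k (Poly_Mapping.lookup p k)"
      "\<lambda>k. Poly_Mapping.single k (Poly_Mapping.lookup q k)"
      "Poly_Mapping.keys p" "Poly_Mapping.keys q"]
  show ?thesis
    by (simp add: sum_single_lookup mult_single map_single mult)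
qed

lemma map_power2:
  fixes p :: "'a poly3"
  shows "Poly_Mapping.map \<sigma> (p\<^sup>2) = (Poly_Mapping.map \<sigma> p)\<^sup>2"
  by (simp add: power2_eq_square map_mult)

end

section \<open>Sums of squares over the rationals\<close>

lemma sum_of_squares_add: "sum_of_squares f \<Longrightarrow> sum_of_squares g \<Longrightarrow> sum_of_squares (f + g)"
  unfolding sum_of_squares_def by (metis map_append sum_list.append)

lemma sum_of_squares_square: "sum_of_squares (f\<^sup>2)"
  unfolding sum_of_squares_def by (rule exI[of _ "[f]"]) simp

text \<open>The constant c = m/n need not be a rational square, but (m/n) f^2 = m n (f/n)^2 is the
  square of f/n repeated m n times.\<close>

lemma sum_of_squares_scale_square:
  fixes f :: "rat poly3"
  assumes "c \<ge> 0"
  shows "sum_of_squares (Poly_Mapping.single 0 c * f\<^sup>2)"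
proof -
  obtain m n :: nat where mn: "n > 0" "c = of_nat m / of_nat n"
  proof -
    obtain a b where ab: "quotient_of c = (a, b)"
      by fastforce
    then have "c = of_int a / of_int b" "b > 0"
      by (simp_all add: quotient_of_div quotient_of_denom_pos)
    moreover from this have "a \<ge> 0"
      using assms by (simp add: zero_le_divide_iff)
    ultimately show ?thesis
      using that[of "nat b" "nat a"] by simp
  qed
  define g where "g = Poly_Mapping.single 0 (1 / of_nat n) * f"
  have "Poly_Mapping.single 0 c * f\<^sup>2 = of_nat (m * n) * g\<^sup>2"
  proof -
    have "of_nat (m * n) * g\<^sup>2 = Poly_Mapping.single 0 (of_nat (m * n)) *
        (Poly_Mapping.single 0 (1 / of_nat n) * Poly_Mapping.single 0 (1 / of_nat n)) * f\<^sup>2"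
      by (simp add: g_def power2_eq_square mult_ac del: of_nat_mult)
    also have "\<dots> = Poly_Mapping.single 0 c * f\<^sup>2"
      using mn by (simp only: mult_single) simp
    finally show ?thesis ..
  qed
  also have "\<dots> = (\<Sum>g\<leftarrow>replicate (m * n) g. g\<^sup>2)"
    by (simp add: sum_list_replicate map_replicate)
  finally show ?thesis
    unfolding sum_of_squares_def by blast
qed

text \<open>With \<open>R\<^sup>2 = b\<close> and \<open>R'\<^sup>2 = b'\<close> conjugate over \<open>\<rat>(\<surd>D)\<close>, where \<open>S = \<surd>D\<close>, the product over the pairs
  \<open>\<plusminus>R\<close> and \<open>\<plusminus>R'\<close> is the relative norm of \<open>A + B S\<close>.\<close>

lemma norm_identity:
  fixes S :: "'a::comm_ring_1"
  assumes "S * S = D" "R * R = b1 + b2 * S" "R' * R' = b1 - b2 * S"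
  shows "(u1 + S * u2 + R * (v1 + S * v2)) * (u1 + S * u2 - R * (v1 + S * v2)) *
      ((u1 - S * u2 + R' * (v1 - S * v2)) * (u1 - S * u2 - R' * (v1 - S * v2))) =
    (u1\<^sup>2 + D * u2\<^sup>2 - b1 * (v1\<^sup>2 + D * v2\<^sup>2) - 2 * b2 * D * v1 * v2)\<^sup>2 -
    D * (2 * u1 * u2 - 2 * b1 * v1 * v2 - b2 * (v1\<^sup>2 + D * v2\<^sup>2))\<^sup>2"
proof -
  define A where "A = u1\<^sup>2 + D * u2\<^sup>2 - b1 * (v1\<^sup>2 + D * v2\<^sup>2) - 2 * b2 * D * v1 * v2"
  define B where "B = 2 * u1 * u2 - 2 * b1 * v1 * v2 - b2 * (v1\<^sup>2 + D * v2\<^sup>2)"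
  have "(u1 + S * u2 + R * (v1 + S * v2)) * (u1 + S * u2 - R * (v1 + S * v2))
      = (u1 + S * u2)\<^sup>2 - (R * R) * (v1 + S * v2)\<^sup>2"
    by (simp add: power2_eq_square algebra_simps)
  also have "\<dots> = A + S * B"
    unfolding A_def B_def assms(2) assms(1)[symmetric] by (simp add: power2_eq_square algebra_simps)
  finally have 1: "(u1 + S * u2 + R * (v1 + S * v2)) * (u1 + S * u2 - R * (v1 + S * v2)) = A + S * B" .
  have "(u1 - S * u2 + R' * (v1 - S * v2)) * (u1 - S * u2 - R' * (v1 - S * v2))
      = (u1 - S * u2)\<^sup>2 - (R' * R') * (v1 - S * v2)\<^sup>2"
    by (simp add: power2_eq_square algebra_simps)
  also have "\<dots> = A - S * B"
    unfolding A_def B_def assms(3) assms(1)[symmetric] by (simp add: power2_eq_square algebra_simps)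
  finally have 2: "(u1 - S * u2 + R' * (v1 - S * v2)) * (u1 - S * u2 - R' * (v1 - S * v2)) = A - S * B" .
  have "(A + S * B) * (A - S * B) = A\<^sup>2 - S * S * B\<^sup>2"
    by (simp add: power2_eq_square algebra_simps)
  then show ?thesis
    unfolding 1 2 assms(1) by (simp only: A_def B_def)
qed

text \<open>The norm of \<open>u\<^sup>2 + a v\<^sup>2\<close>, with \<open>a = a1 + a2 \<surd>D\<close>, is \<open>N(u)\<^sup>2 + N(a) N(v)\<^sup>2 + Tr(a (u' v)\<^sup>2)\<close>,
  and the trace form is diagonalised by completing the square.\<close>

lemma totally_positive_norm_identity:
  fixes D :: "'a::comm_ring_1"
  assumes e: "a1 * e = a2 * D" and h: "h = 2 * a1 * D - 2 * a2 * D * e"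
  shows "(u1\<^sup>2 + D * u2\<^sup>2 + a1 * (v1\<^sup>2 + D * v2\<^sup>2) + 2 * a2 * D * v1 * v2)\<^sup>2 -
      D * (2 * u1 * u2 + 2 * a1 * v1 * v2 + a2 * (v1\<^sup>2 + D * v2\<^sup>2))\<^sup>2 =
    (u1\<^sup>2 - D * u2\<^sup>2)\<^sup>2 + (a1\<^sup>2 - D * a2\<^sup>2) * (v1\<^sup>2 - D * v2\<^sup>2)\<^sup>2 +
    2 * a1 * (u1 * v1 - D * u2 * v2 + e * (u1 * v2 - u2 * v1))\<^sup>2 + h * (u1 * v2 - u2 * v1)\<^sup>2"
proof -
  \<comment> \<open>P and Q are the coordinates of u' v = P + Q \<surd>D, where u = u1 + u2 \<surd>D
    and v = v1 + v2 \<surd>D. The trace of a (u' v)^2 is then 2 a1 (P^2 + D Q^2) + 4 a2 D P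
    Q.\<close>
  define P where "P = u1 * v1 - D * u2 * v2"
  define Q where "Q = u1 * v2 - u2 * v1"
  have "2 * a1 * (P + e * Q)\<^sup>2 = 2 * a1 * P\<^sup>2 + 4 * (a1 * e) * P * Q + 2 * (a1 * e) * e * Q\<^sup>2"
    by (simp add: power2_eq_square algebra_simps)
  then have "2 * a1 * (P + e * Q)\<^sup>2 + h * Q\<^sup>2 = 2 * a1 * (P\<^sup>2 + D * Q\<^sup>2) + 4 * a2 * D * P * Q"
    unfolding e h by (simp add: power2_eq_square algebra_simps)
  then show ?thesis
    unfolding P_def[symmetric] Q_def[symmetric] add.assoc
    by (simp add: P_def Q_def power2_eq_square algebra_simps)
qed

lemma (in field_emb) map_two: "Poly_Mapping.map \<sigma> 2 = (2 :: 'b poly3)"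
  using map_single[of "0 :: 3 \<Rightarrow>\<^sub>0 nat" 2] of_nat[of 2] by simp

context quadratic_tower
begin

text \<open>The norm form of \<open>l\<close>, written as the norm of \<open>A + B \<surd>d\<close>, where \<open>A + B s\<close> is the relative norm
  of \<open>l\<close> over \<open>\<rat>(s)\<close>.\<close>

definition rat_norm_form :: "'k poly3 \<Rightarrow> rat poly3" where
  "rat_norm_form l =
    (let D = Poly_Mapping.single 0 d; B1 = Poly_Mapping.single 0 b1; B2 = Poly_Mapping.single 0 b2;
      u1 = Poly_Mapping.map c1 l; u2 = Poly_Mapping.map c2 l;
      v1 = Poly_Mapping.map c3 l; v2 = Poly_Mapping.map c4 l
    in (u1\<^sup>2 + D * u2\<^sup>2 - B1 * (v1\<^sup>2 + D * v2\<^sup>2) - 2 * B2 * D * v1 * v2)\<^sup>2 -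
      D * (2 * u1 * u2 - 2 * B1 * v1 * v2 - B2 * (v1\<^sup>2 + D * v2\<^sup>2))\<^sup>2)"

lemma map_emb:
  fixes l :: "'k poly3" and \<sigma> :: "'k \<Rightarrow> complex"
  assumes "field_emb \<sigma>"
  defines "q \<equiv> \<lambda>c. Poly_Mapping.map of_rat (Poly_Mapping.map c l)"
  shows "Poly_Mapping.map \<sigma> l = q c1 + Poly_Mapping.single 0 (\<sigma> s) * q c2 +
    Poly_Mapping.single 0 (\<sigma> r) * (q c3 + Poly_Mapping.single 0 (\<sigma> s) * q c4)"
proof (rule poly_mapping_eqI)
  interpret field_emb \<sigma> by fact
  fix k
  have eq: "\<sigma> x = of_rat (c1 x) + \<sigma> s * of_rat (c2 x) + \<sigma> r * (of_rat (c3 x) + \<sigma> s * of_rat (c4 x))" for x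
    by (subst coords[of x]) (simp add: add mult of_rat mult_ac)
  show "Poly_Mapping.lookup (Poly_Mapping.map \<sigma> l) k = Poly_Mapping.lookup (q c1 +
      Poly_Mapping.single 0 (\<sigma> s) * q c2 +
      Poly_Mapping.single 0 (\<sigma> r) * (q c3 + Poly_Mapping.single 0 (\<sigma> s) * q c4)) k"
    unfolding lookup_map[of \<sigma>, OF zero] eq[of "Poly_Mapping.lookup l k"]
    by (simp add: q_def lookup_add lookup_const_mult lookup_map coords0)
qed

lemma norm_form_eq:
  fixes \<sigma> \<tau> :: "'k \<Rightarrow> complex"
  assumes \<sigma>: "field_emb \<sigma>" and \<tau>: "field_emb \<tau>" "\<tau> s = - \<sigma> s"
  shows "norm_form l = Poly_Mapping.map of_rat (rat_norm_form l)"
proof -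
  define q :: "('k \<Rightarrow> rat) \<Rightarrow> complex poly3"
    where "q c = Poly_Mapping.map of_rat (Poly_Mapping.map c l)" for c
  define C :: "complex \<Rightarrow> complex poly3" where "C = Poly_Mapping.single 0"
  have C_uminus: "C (- x) = - C x" and C_add: "C (x + y) = C x + C y"
    and C_mult: "C (x * y) = C x * C y" for x y
    by (simp_all add: C_def single_uminus single_add mult_single)
  have map: "Poly_Mapping.map \<upsilon> l = q c1 + C (\<upsilon> s) * q c2 + C (\<upsilon> r) * (q c3 + C (\<upsilon> s) * q c4)"
    "Poly_Mapping.map (\<upsilon> \<circ> \<rho>) l = q c1 + C (\<upsilon> s) * q c2 - C (\<upsilon> r) * (q c3 + C (\<upsilon> s) * q c4)"
    if "field_emb \<upsilon>" for \<upsilon>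
    using map_emb[OF that, of l] map_emb[OF emb_comp_\<rho>[OF that], of l]
    by (simp_all add: q_def C_def \<rho>s \<rho>r field_emb.uminus[OF that] single_uminus)
  have "norm_form l = Poly_Mapping.map \<sigma> l * Poly_Mapping.map (\<sigma> \<circ> \<rho>) l *
      (Poly_Mapping.map \<tau> l * Poly_Mapping.map (\<tau> \<circ> \<rho>) l)"
    using embeddings_eq(2)[OF \<sigma> \<tau>]
    by (simp add: norm_form_def embeddings_eq(1)[OF \<sigma> \<tau>] mult.assoc)
  \<comment> \<open>As \<open>\<tau> s = - \<sigma> s\<close>, the factors take the shape required
    by \<open>norm_identity\<close>, with \<sigma> r and \<tau> r as square roots of the two
    conjugates of b.\<close>
  also have "\<dots> = (q c1 + C (\<sigma> s) * q c2 + C (\<sigma> r) * (q c3 + C (\<sigma> s) * q c4)) *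
      (q c1 + C (\<sigma> s) * q c2 - C (\<sigma> r) * (q c3 + C (\<sigma> s) * q c4)) *
      ((q c1 - C (\<sigma> s) * q c2 + C (\<tau> r) * (q c3 - C (\<sigma> s) * q c4)) *
      (q c1 - C (\<sigma> s) * q c2 - C (\<tau> r) * (q c3 - C (\<sigma> s) * q c4)))"
    by (simp add: map[OF \<sigma>] map[OF \<tau>(1)] \<tau>(2) C_uminus)
  also have "\<dots> = ((q c1)\<^sup>2 + C (of_rat d) * (q c2)\<^sup>2 - C (of_rat b1) * ((q c3)\<^sup>2 + C (of_rat d) * (q c4)\<^sup>2)
        - 2 * C (of_rat b2) * C (of_rat d) * q c3 * q c4)\<^sup>2 -
      C (of_rat d) * (2 * q c1 * q c2 - 2 * C (of_rat b1) * q c3 * q c4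
        - C (of_rat b2) * ((q c3)\<^sup>2 + C (of_rat d) * (q c4)\<^sup>2))\<^sup>2"
  proof (rule norm_identity)
    show "C (\<sigma> s) * C (\<sigma> s) = C (of_rat d)"
      using emb_s_square[OF \<sigma>] by (simp add: power2_eq_square flip: C_mult)
    show "C (\<sigma> r) * C (\<sigma> r) = C (of_rat b1) + C (of_rat b2) * C (\<sigma> s)"
      using emb_r_square[OF \<sigma>] by (simp add: power2_eq_square flip: C_mult C_add)
    have "C (\<tau> r) * C (\<tau> r) = C (of_rat b1) + C (of_rat b2) * C (\<tau> s)"
      using emb_r_square[OF \<tau>(1)] by (simp add: power2_eq_square flip: C_mult C_add)
    then show "C (\<tau> r) * C (\<tau> r) = C (of_rat b1) - C (of_rat b2) * C (\<sigma> s)"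
      by (simp add: \<tau>(2) C_uminus)
  qed
  also have "\<dots> = Poly_Mapping.map of_rat (rat_norm_form l)"
  proof -
    interpret field_emb "of_rat :: rat \<Rightarrow> complex"
      by (rule field_emb_of_rat)
    show ?thesis
      by (simp add: rat_norm_form_def Let_def q_def C_def map_add map_diff map_mult map_power2
          map_single map_two)
  qed
  finally show ?thesis .
qed

lemma sum_of_squares_rat_norm_form:
  fixes l :: "'k poly3"
  assumes "d > 0 \<Longrightarrow> b1 < 0 \<and> b1\<^sup>2 - d * b2\<^sup>2 > 0"
  shows "sum_of_squares (rat_norm_form l)"
proof -
  define C :: "rat \<Rightarrow> rat poly3" where "C = Poly_Mapping.single 0"
  have C_uminus: "C (- x) = - C x" and C_diff: "C (x - y) = C x - C y"
    and C_mult: "C (x * y) = C x * C y" and C_two: "C 2 = 2" for x y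
    by (simp_all add: C_def single_uminus single_diff mult_single)
  have scale: "sum_of_squares (C c * g\<^sup>2)" if "c \<ge> 0" for c g
    unfolding C_def using that by (rule sum_of_squares_scale_square)
  define u1 u2 v1 v2 where u: "u1 = Poly_Mapping.map c1 l" "u2 = Poly_Mapping.map c2 l"
    and v: "v1 = Poly_Mapping.map c3 l" "v2 = Poly_Mapping.map c4 l"
  define A where "A = u1\<^sup>2 + C d * u2\<^sup>2 - C b1 * (v1\<^sup>2 + C d * v2\<^sup>2) - 2 * C b2 * C d * v1 * v2"
  define B where "B = 2 * u1 * u2 - 2 * C b1 * v1 * v2 - C b2 * (v1\<^sup>2 + C d * v2\<^sup>2)"
  have f: "rat_norm_form l = A\<^sup>2 - C d * B\<^sup>2"
    by (simp add: rat_norm_form_def Let_def A_def B_def C_def u v)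
  show ?thesis
  proof (cases "d > 0")
    case False
    then have "sum_of_squares (A\<^sup>2 + C (- d) * B\<^sup>2)"
      by (intro sum_of_squares_add sum_of_squares_square scale) simp
    then show ?thesis
      by (simp add: f C_uminus)
  next
    case True
    define a1 a2 where a: "a1 = - b1" "a2 = - b2"
    have a1: "a1 > 0" and norm: "a1\<^sup>2 - d * a2\<^sup>2 > 0"
      using assms[OF True] by (simp_all add: a)
    \<comment> \<open>The shift that completes the square in the trace form; h is the coefficient
      left over for Q^2.\<close>
    define e where "e = a2 * d / a1"
    define h where "h = 2 * a1 * d - 2 * a2 * d * e"
    \<comment> \<open>Up to the positive factor 2 d, this is the norm of a, so the second diagonal
      coefficient inherits its sign.\<close>
    have "a1 * h = 2 * d * (a1\<^sup>2 - d * a2\<^sup>2)"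
      using a1 by (simp add: h_def e_def field_simps power2_eq_square)
    then have "h > 0"
      using a1 norm True by (metis mult_pos_pos zero_less_mult_pos zero_less_numeral)
    have "A\<^sup>2 - C d * B\<^sup>2 =
      (u1\<^sup>2 + C d * u2\<^sup>2 + C a1 * (v1\<^sup>2 + C d * v2\<^sup>2) + 2 * C a2 * C d * v1 * v2)\<^sup>2 -
      C d * (2 * u1 * u2 + 2 * C a1 * v1 * v2 + C a2 * (v1\<^sup>2 + C d * v2\<^sup>2))\<^sup>2"
      by (simp add: A_def B_def a C_uminus)
    also have "\<dots> = (u1\<^sup>2 - C d * u2\<^sup>2)\<^sup>2 +
      ((C a1)\<^sup>2 - C d * (C a2)\<^sup>2) * (v1\<^sup>2 - C d * v2\<^sup>2)\<^sup>2 +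
      2 * C a1 * (u1 * v1 - C d * u2 * v2 + C e * (u1 * v2 - u2 * v1))\<^sup>2 +
      C h * (u1 * v2 - u2 * v1)\<^sup>2"
    proof (rule totally_positive_norm_identity)
      show "C a1 * C e = C a2 * C d"
        using a1 by (simp add: e_def flip: C_mult)
      show "C h = 2 * C a1 * C d - 2 * C a2 * C d * C e"
        by (simp add: h_def C_diff C_mult C_two)
    qed
    also have "\<dots> = (u1\<^sup>2 - C d * u2\<^sup>2)\<^sup>2 + C (a1\<^sup>2 - d * a2\<^sup>2) * (v1\<^sup>2 - C d * v2\<^sup>2)\<^sup>2 +
      C (2 * a1) * (u1 * v1 - C d * u2 * v2 + C e * (u1 * v2 - u2 * v1))\<^sup>2 +
      C h * (u1 * v2 - u2 * v1)\<^sup>2"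
      by (simp add: C_diff C_mult C_two power2_eq_square)
    also have "sum_of_squares \<dots>"
      using a1 norm \<open>h > 0\<close>
      by (intro sum_of_squares_add sum_of_squares_square scale) auto
    finally show ?thesis
      by (simp add: f)
  qed
qed

end

section \<open>The characteristic number\<close>

text \<open>The count may be made at the vertex 1. Conjugating t by the rotation or reflection with
  parameter a sends 1 to c a^2 or - c a^2, and a^2 is 1 or -1, so only c and - c are
  reached.\<close>

lemma char_number_square:
  assumes "t \<in> carrier square_group" "is_reflection t" "invariants square_vertices square_action t = {}"
  shows "char_number square_group square_vertices square_action t = 2"
proof -
  interpret involution_action square_group square_vertices square_action t
    by (rule square_involution_action) fact+
  interpret group square_group
    by (rule group_square_group)
  have "t \<in> {\<lambda>z. \<i> * cnj z, \<lambda>z. - \<i> * cnj z}"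
    using assms vertex_free_reflections by blast
  then obtain c where c: "c = \<i> \<or> c = - \<i>" "t = (\<lambda>z. c * cnj z)"
    by blast
  have 1: "1 \<in> square_vertices"
    by (simp add: square_vertices_def)
  have rot: "square_action (g \<otimes>\<^bsub>square_group\<^esub> t \<otimes>\<^bsub>square_group\<^esub> inv\<^bsub>square_group\<^esub> g) 1 = c * a\<^sup>2"
    if a: "a \<in> square_vertices" and g: "g = (\<lambda>z. a * z)" for a g
  proof -
    have "g \<in> carrier square_group" "(\<lambda>z. cnj a * z) \<in> carrier square_group"
      unfolding carrier_square_group using a g by (auto simp: square_vertices_def)
    moreover have "cnj a * a = 1"
      using a by (auto simp: square_vertices_def)
    ultimately have "inv\<^bsub>square_group\<^esub> g = (\<lambda>z. cnj a * z)"
      by (intro inv_equality) (auto simp: square_group_def g fun_eq_iff simp flip: mult.assoc)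
    then show ?thesis
      using 1 by (simp add: square_action_def square_group_def g c(2) power2_eq_square)
  qed
  have ref: "square_action (g \<otimes>\<^bsub>square_group\<^esub> t \<otimes>\<^bsub>square_group\<^esub> inv\<^bsub>square_group\<^esub> g) 1 = - c * a\<^sup>2"
    if a: "a \<in> square_vertices" and g: "g = (\<lambda>z. a * cnj z)" for a g
  proof -
    have "g \<in> carrier square_group"
      unfolding carrier_square_group using a g by auto
    moreover have "a * cnj a = 1"
      using a by (auto simp: square_vertices_def)
    ultimately have "inv\<^bsub>square_group\<^esub> g = g"
      by (intro inv_equality) (auto simp: square_group_def g fun_eq_iff simp flip: mult.assoc)
    then show ?thesis
      using 1 c(1) by (auto simp: square_action_def square_group_def g c(2) power2_eq_square)
  qed
  have "conj_translates square_group square_action t 1 = {c, - c}"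
  proof (intro equalityI subsetI)
    fix y assume "y \<in> conj_translates square_group square_action t 1"
    then obtain g where g: "g \<in> carrier square_group"
      "y = square_action (g \<otimes>\<^bsub>square_group\<^esub> t \<otimes>\<^bsub>square_group\<^esub> inv\<^bsub>square_group\<^esub> g) 1"
      by (auto simp: conj_translates_def)
    then obtain a where a: "a \<in> square_vertices" "y = c * a\<^sup>2 \<or> y = - c * a\<^sup>2"
      using rot ref unfolding carrier_square_group by blast
    then show "y \<in> {c, - c}"
      by (auto simp: square_vertices_def)
  next
    have "c \<in> conj_translates square_group square_action t 1"
      using rot[of 1 "\<lambda>z. 1 * z"] 1 unfolding conj_translates_def carrier_square_group
      by (force simp: square_vertices_def)
    moreover have "- c \<in> conj_translates square_group square_action t 1"
      using ref[of 1 "\<lambda>z. 1 * cnj z"] 1 unfolding conj_translates_def carrier_square_group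
      by (force simp: square_vertices_def)
    moreover fix y assume "y \<in> {c, - c}"
    ultimately show "y \<in> conj_translates square_group square_action t 1"
      by blast
  qed
  moreover have "c \<noteq> - c"
    using c(1) by (auto simp: complex_eq_iff)
  ultimately show ?thesis
    using card_conj_translates[OF 1] by simp
qed

theorem mainTheorem2:
  shows
    "(\<forall>t \<in> carrier square_group.
        is_reflection t \<and> invariants square_vertices square_action t = {} \<longrightarrow>
        char_number square_group square_vertices square_action t = 2 \<and>
        (2::real) = 1 / 2 * real (card square_vertices)) \<and>
     (degree_over_Q TYPE('k::field_char_0) = 4 \<and>
      totally_imaginary TYPE('k) \<and>
      galois_group (galois_hull TYPE('k)) \<cong> square_group \<longrightarrow>
      (\<forall>l :: 'k poly3. linear_form l \<longrightarrow>
        (\<exists>f :: rat poly3. Poly_Mapping.map of_rat f = norm_form l \<and> sum_of_squares f)))"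
proof (intro conjI ballI impI allI)
  show "(2::real) = 1 / 2 * real (card square_vertices)"
    by (simp add: square_vertices_def complex_eq_iff)
next
  fix l :: "'k poly3"
  assume "degree_over_Q TYPE('k) = 4 \<and> totally_imaginary TYPE('k) \<and>
    galois_group (galois_hull TYPE('k)) \<cong> square_group"
  then have deg: "degree_over_Q TYPE('k) = 4" and ti: "totally_imaginary TYPE('k)"
    and iso: "galois_group (galois_hull TYPE('k)) \<cong> square_group"
    by auto
  have alg: "algebraic_over_Q TYPE('k)"
    by (rule algebraic_over_Q_if_degree_pos) (simp add: deg)
  obtain \<sigma> :: "'k \<Rightarrow> complex" and \<rho> :: "'k \<Rightarrow> 'k" where \<sigma>: "field_emb \<sigma>"
    and \<rho>: "field_emb \<rho>" "\<And>x. \<rho> (\<rho> x) = x" "\<exists>x. \<rho> x \<noteq> x"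
    using ex_field_involution[OF alg iso] by blast
  obtain s r d b1 b2 c1 c2 c3 c4 where bi: "quadratic_tower \<rho> s r d b1 b2 c1 c2 c3 c4"
    by (rule ex_quadratic_tower[OF deg \<rho>])
  interpret quadratic_tower \<rho> s r d b1 b2 c1 c2 c3 c4
    by (rule bi)
  obtain \<tau> :: "'k \<Rightarrow> complex" where \<tau>: "field_emb \<tau>" "\<tau> s = - \<sigma> s"
    by (rule ex_conjugate_embedding[OF alg \<sigma>])
  show "\<exists>f. Poly_Mapping.map of_rat f = norm_form l \<and> sum_of_squares f"
    using norm_form_eq[OF \<sigma> \<tau>, of l] sum_of_squares_rat_norm_form[of l]
      totally_negative[OF ti \<sigma> \<tau>] by auto
qed (use char_number_square in blast)

end
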